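(* Let $(\Gamma,\mathbb P)$ be a relatively hyperbolic pair with finitely generated peripheral subgroups (the members of $\mathbb P$). Suppose $X_1$ and $X_2$ are weak cusped spaces for $(\Gamma,\mathbb P)$ (whose Gromov boundaries contain at least three points). If there exists a $\Gamma$-equivariant quasisymmetric homeomorphism $\partial X_1\to\partial X_2$ and $X_1$ is a cusped space for $(\Gamma,\mathbb P)$, then $X_2$ is also a cusped space for $(\Gamma,\mathbb P)$.
   Context: A group pair $(\Gamma,\mathbb P)$ is a group $\Gamma$ with a finite family $\mathbb P$ of subgroups. A $\delta$-hyperbolic space is a geodesic metric space all of whose geodesic triangles are $\delta$-thin; $\partial X$ denotes the Gromov boundary. A proper $\delta$-hyperbolic space $X$ is visual if there are $w\in X$ and $C<\infty$ such that for each $x\in X$ some geodesic ray based at $w$ meets the closed ball $B(x,C)$. A function $h\colon X\to\mathbb R$ is a horofunction about $\eta\in\partial X$ if there is $D_1<\infty$ such that $|h(w)-h(x)-d(x,w)|\le D_1$ whenever $x,w\in X$ and $w$ is within $5\delta$ of some geodesic ray from $x$ to $\eta$; an open horoball about $\eta$ is a set $h^{-1}(0,\infty)$ with $h$ a horofunction about $\eta$. If a group acts properly discontinuously and isometrically on $X$, a subgroup is parabolic if its orbits are unbounded and have exactly one accumulation point in $\partial X$ (a parabolic point); maximal parabolic subgroups are the stabilizers of parabolic points. A cusp-uniform action of $(\Gamma,\mathbb P)$ on a proper, visual $\delta$-hyperbolic space $X$ is a properly discontinuous isometric action of $\Gamma$ such that $\mathbb P$ is a set of representatives of the conjugacy classes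 of maximal parabolic subgroups and there is a $\Gamma$-equivariant family of pairwise disjoint open horoballs (centered at the parabolic points), with union $U$, such that $\Gamma$ acts cocompactly on $X\setminus U$. Then $X$ is a weak cusped space for $(\Gamma,\mathbb P)$. The pair $(\Gamma,\mathbb P)$ is relatively hyperbolic if it admits a cusp-uniform action on some such $X$. Such an $X$ is a cusped space for $(\Gamma,\mathbb P)$ if every horoball in the family has constant horospherical distortion: if $P$ is the (finitely generated) stabilizer of the horoball, $d_P$ a word metric on $P$ for a finite generating set, and $y_0$ a point of the horoball, there are a bilipschitz homeomorphism $g\colon[0,\infty)\to[0,\infty)$ and a constant $B>0$ such that $\frac1B e^{g(d_X(py_0,p'y_0))}\le d_P(p,p')\le B e^{g(d_X(py_0,p'y_0))}$ for all distinct $p,p'\in P$. Extend the Gromov product to $\partial X$ by $(\xi|\xi')_w=\inf\liminf_i(z_i|z'_i)_w$ over sequences $z_i\to\xi$, $z'_i\to\xi'$ in $X$. A metric $\rho$ on $\partial X$ is visual if for some $w\in X$, $a>1$, $c_1,c_2>0$, $c_1a^{-(\xi|\xi')_w}\le\rho(\xi,\xi')\le c_2a^{-(\xi|\xi')_w}$ for all $\xi,\xi'$. A homeomorphism $f$ of metric spaces is quasisymmetric if there is a homeomorphism $\eta\colon[0,\infty)\to[0,\infty)$ with $d(x,a)\le t\,d(x,b)\Rightarrow d(f(x),f(a))\le\eta(t)d(f(x),f(b))$ for all $t\ge0$ and points $x,a,b$. A map between Gromov boundaries is quasisymmetric if it is so for some (equivalently every) choice of visual metrics. *)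

theory Defs
  imports "HOL-Analysis.Analysis" "HOL-Algebra.Group_Action" "HOL-Algebra.Generated_Groups"
begin

section \<open>Hyperbolic spaces\<close>

definition proper_space :: "'x::metric_space itself \<Rightarrow> bool" where
  "proper_space _ \<longleftrightarrow> (\<forall>(x::'x) r. compact (cball x r))"

definition geodesic_segment :: "'x::metric_space \<Rightarrow> 'x \<Rightarrow> 'x set \<Rightarrow> bool" where
  "geodesic_segment x y S \<longleftrightarrow>
     (\<exists>c. c 0 = x \<and> c (dist x y) = y \<and>
          (\<forall>s\<in>{0..dist x y}. \<forall>t\<in>{0..dist x y}. dist (c s) (c t) = \<bar>s - t\<bar>) \<and>
          S = c ` {0..dist x y})"

definition geodesic_ray :: "(real \<Rightarrow> 'x::metric_space) \<Rightarrow> 'x \<Rightarrow> bool" where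
  "geodesic_ray c x \<longleftrightarrow> c 0 = x \<and> (\<forall>s\<ge>0. \<forall>t\<ge>0. dist (c s) (c t) = \<bar>s - t\<bar>)"

text \<open>Triangles are thin in the sense that each side lies in the closed neighbourhood of radius
  \<open>\<delta>\<close> of the union of the other two. It is enough to test the first side, since the three
  sides may be permuted cyclically.\<close>

definition hyperbolic_space :: "'x::metric_space itself \<Rightarrow> real \<Rightarrow> bool" where
  "hyperbolic_space _ \<delta> \<longleftrightarrow>
     (\<forall>x y::'x. \<exists>S. geodesic_segment x y S) \<and>
     (\<forall>(x::'x) y z S1 S2 S3.
        geodesic_segment x y S1 \<longrightarrow> geodesic_segment y z S2 \<longrightarrow> geodesic_segment z x S3 \<longrightarrow>
        (\<forall>p\<in>S1. \<exists>q\<in>S2 \<union> S3. dist p q \<le> \<delta>))"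

definition visual_space :: "'x::metric_space itself \<Rightarrow> bool" where
  "visual_space _ \<longleftrightarrow>
     (\<exists>(w::'x) C. \<forall>x. \<exists>c. geodesic_ray c w \<and> (\<exists>t\<ge>0. c t \<in> cball x C))"

section \<open>The Gromov boundary\<close>

definition gromov_product :: "'x::metric_space \<Rightarrow> 'x \<Rightarrow> 'x \<Rightarrow> real" where
  "gromov_product w x y = (dist x w + dist y w - dist x y) / 2"

definition converges_to_infinity :: "(nat \<Rightarrow> 'x::metric_space) \<Rightarrow> bool" where
  "converges_to_infinity z \<longleftrightarrow>
     (\<forall>w. filterlim (\<lambda>(i, j). gromov_product w (z i) (z j)) at_top (sequentially \<times>\<^sub>F sequentially))"

definition boundary_rel :: "((nat \<Rightarrow> 'x::metric_space) \<times> (nat \<Rightarrow> 'x)) set" where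
  "boundary_rel = {(z, z'). converges_to_infinity z \<and> converges_to_infinity z' \<and>
     (\<forall>w. filterlim (\<lambda>i. gromov_product w (z i) (z' i)) at_top sequentially)}"

text \<open>A boundary point is an equivalence class of sequences, so that \<open>z \<in> \<xi>\<close> says that the
  sequence \<open>z\<close> in the space converges to \<open>\<xi>\<close>.\<close>

definition gromov_boundary :: "(nat \<Rightarrow> 'x::metric_space) set set" where
  "gromov_boundary = {z. converges_to_infinity z} // boundary_rel"

definition geodesic_ray_to :: "(real \<Rightarrow> 'x::metric_space) \<Rightarrow> 'x \<Rightarrow> (nat \<Rightarrow> 'x) set \<Rightarrow> bool" where
  "geodesic_ray_to c x \<xi> \<longleftrightarrow> geodesic_ray c x \<and> (\<lambda>n. c (real n)) \<in> \<xi>"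

definition boundary_act :: "('g \<Rightarrow> 'x \<Rightarrow> 'x) \<Rightarrow> 'g \<Rightarrow> (nat \<Rightarrow> 'x) set \<Rightarrow> (nat \<Rightarrow> 'x) set" where
  "boundary_act act g \<xi> = (\<lambda>z. act g \<circ> z) ` \<xi>"

definition boundary_product ::
  "'x::metric_space \<Rightarrow> (nat \<Rightarrow> 'x) set \<Rightarrow> (nat \<Rightarrow> 'x) set \<Rightarrow> ereal" where
  "boundary_product w \<xi> \<xi>' =
     (INF (z, z')\<in>\<xi> \<times> \<xi>'. liminf (\<lambda>i. ereal (gromov_product w (z i) (z' i))))"

text \<open>\<open>a\<close> to the power \<open>-e\<close>, with the convention that the power is \<open>0\<close> for \<open>e = \<infinity>\<close>; the case
  distinction is needed because \<^term>\<open>real_of_ereal \<infinity> = 0\<close>.\<close>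

definition neg_power :: "real \<Rightarrow> ereal \<Rightarrow> real" where
  "neg_power a e = (if e = \<infinity> then 0 else a powr (- real_of_ereal e))"

definition visual_metric ::
  "((nat \<Rightarrow> 'x::metric_space) set \<Rightarrow> (nat \<Rightarrow> 'x) set \<Rightarrow> real) \<Rightarrow> bool" where
  "visual_metric \<rho> \<longleftrightarrow> Metric_space gromov_boundary \<rho> \<and>
     (\<exists>w a c1 c2. a > 1 \<and> c1 > 0 \<and> c2 > 0 \<and>
        (\<forall>\<xi>\<in>gromov_boundary. \<forall>\<xi>'\<in>gromov_boundary.
           c1 * neg_power a (boundary_product w \<xi> \<xi>') \<le> \<rho> \<xi> \<xi>' \<and>
           \<rho> \<xi> \<xi>' \<le> c2 * neg_power a (boundary_product w \<xi> \<xi>')))"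

definition quasisymmetric_homeomorphism ::
  "'a set \<Rightarrow> ('a \<Rightarrow> 'a \<Rightarrow> real) \<Rightarrow> 'b set \<Rightarrow> ('b \<Rightarrow> 'b \<Rightarrow> real) \<Rightarrow> ('a \<Rightarrow> 'b) \<Rightarrow> bool" where
  "quasisymmetric_homeomorphism M d M' d' f \<longleftrightarrow>
     homeomorphic_map (Metric_space.mtopology M d) (Metric_space.mtopology M' d') f \<and>
     (\<exists>\<eta> \<eta>'. homeomorphism {0::real..} {0::real..} \<eta> \<eta>' \<and>
        (\<forall>t\<ge>0. \<forall>x\<in>M. \<forall>a\<in>M. \<forall>b\<in>M.
           d x a \<le> t * d x b \<longrightarrow> d' (f x) (f a) \<le> \<eta> t * d' (f x) (f b)))"

definition boundary_quasisymmetric ::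
  "((nat \<Rightarrow> 'x::metric_space) set \<Rightarrow> (nat \<Rightarrow> 'y::metric_space) set) \<Rightarrow> bool" where
  "boundary_quasisymmetric f \<longleftrightarrow>
     (\<exists>\<rho> \<rho>'. visual_metric \<rho> \<and> visual_metric \<rho>' \<and>
        quasisymmetric_homeomorphism gromov_boundary \<rho> gromov_boundary \<rho>' f)"

definition horofunction ::
  "real \<Rightarrow> (nat \<Rightarrow> 'x::metric_space) set \<Rightarrow> ('x \<Rightarrow> real) \<Rightarrow> bool" where
  "horofunction \<delta> \<eta> h \<longleftrightarrow>
     (\<exists>D. \<forall>x w. (\<exists>c. geodesic_ray_to c x \<eta> \<and> infdist w (c ` {0..}) \<le> 5 * \<delta>) \<longrightarrow>
        \<bar>h w - h x - dist x w\<bar> \<le> D)"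

definition open_horoball :: "real \<Rightarrow> (nat \<Rightarrow> 'x::metric_space) set \<Rightarrow> 'x set \<Rightarrow> bool" where
  "open_horoball \<delta> \<eta> H \<longleftrightarrow> (\<exists>h. horofunction \<delta> \<eta> h \<and> H = h -` {0<..})"

section \<open>Group pairs and their actions\<close>

definition group_pair :: "('g, 'm) monoid_scheme \<Rightarrow> 'g set set \<Rightarrow> bool" where
  "group_pair G \<P> \<longleftrightarrow> group G \<and> finite \<P> \<and> (\<forall>P\<in>\<P>. subgroup P G)"

definition finite_generating_set :: "('g, 'm) monoid_scheme \<Rightarrow> 'g set \<Rightarrow> 'g set \<Rightarrow> bool" where
  "finite_generating_set G P S \<longleftrightarrow> finite S \<and> S \<subseteq> P \<and> generate G S = P"

definition word_length :: "('g, 'm) monoid_scheme \<Rightarrow> 'g set \<Rightarrow> 'g \<Rightarrow> nat" where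
  "word_length G S g =
     (LEAST n. \<exists>ws. length ws = n \<and> set ws \<subseteq> S \<union> m_inv G ` S \<and>
                    foldr (\<lambda>a b. a \<otimes>\<^bsub>G\<^esub> b) ws \<one>\<^bsub>G\<^esub> = g)"

definition word_metric :: "('g, 'm) monoid_scheme \<Rightarrow> 'g set \<Rightarrow> 'g \<Rightarrow> 'g \<Rightarrow> real" where
  "word_metric G S p q = real (word_length G S (inv\<^bsub>G\<^esub> p \<otimes>\<^bsub>G\<^esub> q))"

definition isometric_action ::
  "('g, 'm) monoid_scheme \<Rightarrow> ('g \<Rightarrow> 'x::metric_space \<Rightarrow> 'x) \<Rightarrow> bool" where
  "isometric_action G act \<longleftrightarrow> group_action G UNIV act \<and>
     (\<forall>g\<in>carrier G. \<forall>x y. dist (act g x) (act g y) = dist x y)"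

definition properly_discontinuous ::
  "('g, 'm) monoid_scheme \<Rightarrow> ('g \<Rightarrow> 'x::metric_space \<Rightarrow> 'x) \<Rightarrow> bool" where
  "properly_discontinuous G act \<longleftrightarrow>
     (\<forall>K. compact K \<longrightarrow> finite {g \<in> carrier G. act g ` K \<inter> K \<noteq> {}})"

definition cocompact_on ::
  "('g, 'm) monoid_scheme \<Rightarrow> ('g \<Rightarrow> 'x::metric_space \<Rightarrow> 'x) \<Rightarrow> 'x set \<Rightarrow> bool" where
  "cocompact_on G act Y \<longleftrightarrow> (\<exists>K. compact K \<and> K \<subseteq> Y \<and> (\<Union>g\<in>carrier G. act g ` K) = Y)"

definition orbit_accumulation_points ::
  "('g \<Rightarrow> 'x::metric_space \<Rightarrow> 'x) \<Rightarrow> 'g set \<Rightarrow> 'x \<Rightarrow> (nat \<Rightarrow> 'x) set set" where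
  "orbit_accumulation_points act H x =
     {\<xi> \<in> gromov_boundary. \<exists>h. range h \<subseteq> H \<and> (\<lambda>n. act (h n) x) \<in> \<xi>}"

definition parabolic_at ::
  "('g, 'm) monoid_scheme \<Rightarrow> ('g \<Rightarrow> 'x::metric_space \<Rightarrow> 'x) \<Rightarrow> 'g set \<Rightarrow> (nat \<Rightarrow> 'x) set \<Rightarrow> bool" where
  "parabolic_at G act H \<xi> \<longleftrightarrow> subgroup H G \<and>
     (\<forall>x. \<not> bounded ((\<lambda>h. act h x) ` H) \<and> orbit_accumulation_points act H x = {\<xi>})"

definition parabolic_points ::
  "('g, 'm) monoid_scheme \<Rightarrow> ('g \<Rightarrow> 'x::metric_space \<Rightarrow> 'x) \<Rightarrow> (nat \<Rightarrow> 'x) set set" where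
  "parabolic_points G act = {\<xi>. \<exists>H. parabolic_at G act H \<xi>}"

definition maximal_parabolic_subgroups ::
  "('g, 'm) monoid_scheme \<Rightarrow> ('g \<Rightarrow> 'x::metric_space \<Rightarrow> 'x) \<Rightarrow> 'g set set" where
  "maximal_parabolic_subgroups G act = stabilizer G (boundary_act act) ` parabolic_points G act"

definition conjugacy_representatives ::
  "('g, 'm) monoid_scheme \<Rightarrow> 'g set set \<Rightarrow> 'g set set \<Rightarrow> bool" where
  "conjugacy_representatives G \<Q> \<P> \<longleftrightarrow> \<P> \<subseteq> \<Q> \<and>
     (\<forall>Q\<in>\<Q>. \<exists>!P. P \<in> \<P> \<and> (\<exists>g\<in>carrier G. Q = g <#\<^bsub>G\<^esub> P #>\<^bsub>G\<^esub> (inv\<^bsub>G\<^esub> g)))"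

text \<open>The family of horoballs is indexed by the parabolic points; its values elsewhere are
  irrelevant.\<close>

definition cusp_uniform_horoballs ::
  "real \<Rightarrow> ('g, 'm) monoid_scheme \<Rightarrow> ('g \<Rightarrow> 'x::metric_space \<Rightarrow> 'x) \<Rightarrow>
   ((nat \<Rightarrow> 'x) set \<Rightarrow> 'x set) \<Rightarrow> bool" where
  "cusp_uniform_horoballs \<delta> G act B \<longleftrightarrow>
     (\<forall>\<xi>\<in>parabolic_points G act. open_horoball \<delta> \<xi> (B \<xi>)) \<and>
     (\<forall>g\<in>carrier G. \<forall>\<xi>\<in>parabolic_points G act. B (boundary_act act g \<xi>) = act g ` B \<xi>) \<and>
     disjoint_family_on B (parabolic_points G act) \<and>
     cocompact_on G act (UNIV - (\<Union>\<xi>\<in>parabolic_points G act. B \<xi>))"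

definition cusp_uniform_action_with ::
  "real \<Rightarrow> ('g, 'm) monoid_scheme \<Rightarrow> 'g set set \<Rightarrow> ('g \<Rightarrow> 'x::metric_space \<Rightarrow> 'x) \<Rightarrow>
   ((nat \<Rightarrow> 'x) set \<Rightarrow> 'x set) \<Rightarrow> bool" where
  "cusp_uniform_action_with \<delta> G \<P> act B \<longleftrightarrow>
     group_pair G \<P> \<and>
     proper_space TYPE('x) \<and> hyperbolic_space TYPE('x) \<delta> \<and> visual_space TYPE('x) \<and>
     isometric_action G act \<and> properly_discontinuous G act \<and>
     conjugacy_representatives G (maximal_parabolic_subgroups G act) \<P> \<and>
     cusp_uniform_horoballs \<delta> G act B"

definition weak_cusped_space ::
  "real \<Rightarrow> ('g, 'm) monoid_scheme \<Rightarrow> 'g set set \<Rightarrow> ('g \<Rightarrow> 'x::metric_space \<Rightarrow> 'x) \<Rightarrow> bool" where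
  "weak_cusped_space \<delta> G \<P> act \<longleftrightarrow> (\<exists>B. cusp_uniform_action_with \<delta> G \<P> act B)"

text \<open>The space carrying the action is a type here and cannot be quantified inside a definition,
  hence the type argument. In a theorem, a type variable occurring only in an assumption of this
  form says that some space of the required kind exists.\<close>

definition relatively_hyperbolic ::
  "'x::metric_space itself \<Rightarrow> ('g, 'm) monoid_scheme \<Rightarrow> 'g set set \<Rightarrow> bool" where
  "relatively_hyperbolic _ G \<P> \<longleftrightarrow>
     (\<exists>\<delta> (act :: 'g \<Rightarrow> 'x \<Rightarrow> 'x). weak_cusped_space \<delta> G \<P> act)"

section \<open>Cusped spaces\<close>

definition bilipschitz_homeomorphism :: "(real \<Rightarrow> real) \<Rightarrow> bool" where
  "bilipschitz_homeomorphism g \<longleftrightarrow>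
     (\<exists>g' L. homeomorphism {0..} {0..} g g' \<and> L-lipschitz_on {0..} g \<and> L-lipschitz_on {0..} g')"

text \<open>The condition does not depend on the generating set \<open>S\<close> or the point \<open>y\<close> of the horoball
  \<open>H\<close>, so it is stated for all of them; a finite generating set is required to exist.\<close>

definition constant_horospherical_distortion ::
  "('g, 'm) monoid_scheme \<Rightarrow> ('g \<Rightarrow> 'x::metric_space \<Rightarrow> 'x) \<Rightarrow> 'x set \<Rightarrow> bool" where
  "constant_horospherical_distortion G act H \<longleftrightarrow>
     (let P = stabilizer G (\<lambda>g. image (act g)) H in
        (\<exists>S. finite_generating_set G P S) \<and>
        (\<forall>S y. finite_generating_set G P S \<longrightarrow> y \<in> H \<longrightarrow>
           (\<exists>g B. bilipschitz_homeomorphism g \<and> B > 0 \<and>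
              (\<forall>p\<in>P. \<forall>q\<in>P. p \<noteq> q \<longrightarrow>
                 1 / B * exp (g (dist (act p y) (act q y))) \<le> word_metric G S p q \<and>
                 word_metric G S p q \<le> B * exp (g (dist (act p y) (act q y)))))))"

definition cusped_space ::
  "real \<Rightarrow> ('g, 'm) monoid_scheme \<Rightarrow> 'g set set \<Rightarrow> ('g \<Rightarrow> 'x::metric_space \<Rightarrow> 'x) \<Rightarrow> bool" where
  "cusped_space \<delta> G \<P> act \<longleftrightarrow>
     (\<exists>B. cusp_uniform_action_with \<delta> G \<P> act B \<and>
        (\<forall>\<xi>\<in>parabolic_points G act. constant_horospherical_distortion G act (B \<xi>)))"

end

theory Submission
  imports Defs
begin

text \<open>Let \<open>P\<close> be the stabilizer of a parabolic point \<open>\<xi>\<close>, let \<open>\<zeta> \<noteq> \<xi>\<close> be another boundary point and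
  \<open>y\<close> a point of the horoball at \<open>\<xi>\<close>. Since \<open>P\<close> preserves the horoball, it moves \<open>y\<close> along a
  horosphere up to a bounded error, and therefore \<open>(\<xi>|p\<zeta>)\<^sub>y\<close> equals \<open>d(y, py) / 2\<close> up to a bounded
  error. Thus the visual distance from \<open>\<xi>\<close> to \<open>p\<zeta>\<close> is comparable with \<open>exp (- \<kappa> d(y, py))\<close>. An
  equivariant quasisymmetric map sends \<open>\<xi>\<close> to the point with the same stabilizer and \<open>p\<zeta>\<close> to \<open>pf(\<zeta>)\<close>,
  so it makes the displacement of \<open>p\<close> on the second space a coarsely monotone function, with bounded
  growth, of the displacement on the first. As word lengths in \<open>P\<close> take all values, interpolation
  along powers of a fixed integer turns the exponential law on the first space into one on the second.\<close>

section \<open>Gromov hyperbolic spaces\<close>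

text \<open>Exponential distortion determines the exponent function up to a bounded additive error,
  and quasisymmetry compares the two displacements only up to additive errors as well. A bilipschitz
  function, however, has to be controlled at small scales, where such errors hide everything. This
  is why the new function is interpolated from widely spaced samples. Their gaps are bounded above
  because the control function of the quasisymmetry is finite, and below because it becomes small
  near 0. The quasisymmetric inequality is always centred at \<open>\<xi>\<close>, with the other
  two points in one orbit, so only ratios of distances from \<open>\<xi>\<close> to points
  \<open>p \<zeta>\<close> enter. Equivariance alone shows that the stabilizer of
  \<open>\<xi>\<close> fixes \<open>f \<xi>\<close>, not that \<open>f \<xi>\<close> is the
  parabolic point \<open>\<eta>\<close> with that stabilizer. The identification comes from
  dynamics: elements of large displacement would push one point towards both. A third boundary point
  is needed to choose a \<open>\<zeta>\<close> that is neither \<open>\<xi>\<close> nor the preimage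
  of \<open>\<eta>\<close>.\<close>

lemma double_gromov_product: "2 * gromov_product w x y = dist x w + dist y w - dist x y"
  by (simp add: gromov_product_def)

lemma gromov_product_commute: "gromov_product w x y = gromov_product w y x"
  by (simp add: gromov_product_def dist_commute)

lemma gromov_product_nonneg: "0 \<le> gromov_product w x y"
  using dist_triangle2[of x y w] by (simp add: gromov_product_def)

lemma gromov_product_le_dist: "gromov_product w x y \<le> dist w x"
  using dist_triangle[of y w x] by (simp add: gromov_product_def dist_commute)

lemma gromov_product_self [simp]: "gromov_product w x x = dist w x"
  by (simp add: gromov_product_def dist_commute)

lemma gromov_product_base: "gromov_product w x y \<le> gromov_product w' x y + dist w w'"
  using dist_triangle[of x w w'] dist_triangle[of y w w'] dist_commute[of w w']
    double_gromov_product[of w x y] double_gromov_product[of w' x y] by linarith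

lemma gromov_product_perturb: "gromov_product w x y \<le> gromov_product w x' y + dist x x'"
  using dist_triangle[of x w x'] dist_triangle[of x' y x] dist_commute[of x x']
    double_gromov_product[of w x y] double_gromov_product[of w x' y] by linarith

lemma gromov_product_le_dist_segment:
  assumes "geodesic_segment x y S" "q \<in> S"
  shows "gromov_product w x y \<le> dist w q"
proof -
  obtain c t where c: "c 0 = x" "c (dist x y) = y" "t \<in> {0..dist x y}" "q = c t"
    "\<forall>s\<in>{0..dist x y}. \<forall>t\<in>{0..dist x y}. dist (c s) (c t) = \<bar>s - t\<bar>"
    using assms unfolding geodesic_segment_def by auto
  have "dist x q = t" "dist q y = dist x y - t"
    using c(5)[rule_format, of 0 t] c(5)[rule_format, of t "dist x y"] c by auto
  then show ?thesis
    using dist_triangle[of x w q] dist_triangle[of y w q]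
    by (simp add: gromov_product_def dist_commute)
qed

lemma geodesic_segment_dist:
  assumes "geodesic_segment x y S" "q \<in> S"
  shows "dist x q \<le> dist x y"
proof -
  obtain c t where c: "c 0 = x" "t \<in> {0..dist x y}" "q = c t"
    "\<forall>s\<in>{0..dist x y}. \<forall>t\<in>{0..dist x y}. dist (c s) (c t) = \<bar>s - t\<bar>"
    using assms unfolding geodesic_segment_def by auto
  then show ?thesis using c(4)[rule_format, of 0 t] by auto
qed

lemma hyperbolic_space_segment:
  assumes "hyperbolic_space TYPE('x::metric_space) \<delta>"
  obtains S where "geodesic_segment (x::'x) y S"
  using assms unfolding hyperbolic_space_def by blast

lemma hyperbolic_space_thin:
  fixes x y z :: "'x::metric_space"
  assumes "hyperbolic_space TYPE('x) \<delta>" "geodesic_segment x y S1" "geodesic_segment y z S2"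
    "geodesic_segment z x S3" "p \<in> S1"
  obtains q where "q \<in> S2 \<union> S3" "dist p q \<le> \<delta>"
  using assms unfolding hyperbolic_space_def by blast

text \<open>Thinness of a degenerate triangle at a single point forces the sign.\<close>

lemma hyperbolic_space_nonneg:
  assumes "hyperbolic_space TYPE('x::metric_space) \<delta>"
  shows "0 \<le> \<delta>"
proof -
  fix x :: 'x
  obtain S where S: "geodesic_segment x x S" using hyperbolic_space_segment[OF assms] .
  then have "x \<in> S" unfolding geodesic_segment_def by force
  then obtain q where "dist x q \<le> \<delta>" using hyperbolic_space_thin[OF assms S S S] by blast
  then show ?thesis using zero_le_dist[of x q] by linarith
qed

text \<open>By connectedness, some point of the side \<open>[x, y]\<close> is close to both other sides.\<close>

lemma hyperbolic_segment_near:
  fixes x y w :: "'x::metric_space"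
  assumes hyp: "hyperbolic_space TYPE('x) \<delta>" and S: "geodesic_segment x y S"
  shows "\<exists>q\<in>S. dist w q \<le> gromov_product w x y + 2 * \<delta>"
proof -
  have d0: "0 \<le> \<delta>" using hyperbolic_space_nonneg[OF hyp] .
  obtain c where c: "c 0 = x" "c (dist x y) = y" "S = c ` {0..dist x y}"
    and iso: "\<And>s t. s \<in> {0..dist x y} \<Longrightarrow> t \<in> {0..dist x y} \<Longrightarrow> dist (c s) (c t) = \<bar>s - t\<bar>"
    using S unfolding geodesic_segment_def by auto
  have cont: "continuous_on {0..dist x y} c"
    by (rule lipschitz_on_continuous_on[of 1]) (auto simp: lipschitz_on_def iso dist_real_def)
  obtain S2 S3 where S23: "geodesic_segment y w S2" "geodesic_segment w x S3"
    using hyperbolic_space_segment[OF hyp] by metis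
  \<comment> \<open>\<open>A\<close> and \<open>A'\<close> collect the parameters at which a detour
    through \<open>c t\<close> from \<open>x\<close>, respectively \<open>y\<close>, to
    \<open>w\<close> costs at most \<open>2 * \<delta>\<close>. At a common parameter the two
    inequalities add up to the claim.\<close>
  define A where "A = {t \<in> {0..dist x y}. dist x (c t) + dist (c t) w \<le> dist x w + 2 * \<delta>}"
  define A' where "A' = {t \<in> {0..dist x y}. dist y (c t) + dist (c t) w \<le> dist y w + 2 * \<delta>}"
  have "closed A" "closed A'"
    unfolding A_def A'_def by (intro continuous_on_closed_Collect_le continuous_intros cont; simp)+
  moreover have "{0..dist x y} \<subseteq> A \<union> A'"
  proof
    fix t assume t: "t \<in> {0..dist x y}"
    then have "c t \<in> S" using c by auto
    then obtain q where q: "q \<in> S2 \<union> S3" "dist (c t) q \<le> \<delta>"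
      using hyperbolic_space_thin[OF hyp S S23] by blast
    have split: "dist a q + dist q b = dist a b" if seg: "geodesic_segment a b T" "q \<in> T" for a b T
    proof -
      obtain e s where e: "e 0 = a" "e (dist a b) = b" "s \<in> {0..dist a b}" "q = e s"
        "\<forall>s\<in>{0..dist a b}. \<forall>t\<in>{0..dist a b}. dist (e s) (e t) = \<bar>s - t\<bar>"
        using seg unfolding geodesic_segment_def by auto
      then show ?thesis using e(5)[rule_format, of 0 s] e(5)[rule_format, of s "dist a b"] by auto
    qed
    show "t \<in> A \<union> A'"
    proof (cases "q \<in> S2")
      case True
      then have "dist y q + dist q w = dist y w" using split S23 by auto
      then have "dist y (c t) + dist (c t) w \<le> dist y w + 2 * \<delta>"
        using dist_triangle[of y "c t" q] dist_triangle[of "c t" w q] q(2)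
        by (simp add: dist_commute)
      then show ?thesis using t by (auto simp: A'_def)
    next
      case False
      then have "dist w q + dist q x = dist w x" using split S23 q by auto
      then have "dist x (c t) + dist (c t) w \<le> dist x w + 2 * \<delta>"
        using dist_triangle[of x "c t" q] dist_triangle[of "c t" w q] q(2)
        by (simp add: dist_commute)
      then show ?thesis using t by (auto simp: A_def)
    qed
  qed
  moreover have "0 \<in> A" "dist x y \<in> A'" using d0 c by (auto simp: A_def A'_def)
  moreover have "connected {0..dist x y}" by simp
  ultimately have "A \<inter> A' \<inter> {0..dist x y} \<noteq> {}"
    using connected_closed[of "{0..dist x y}"] zero_le_dist[of x y]
    by (metis atLeastAtMost_iff disjoint_iff order_refl)
  then obtain t where t: "t \<in> A" "t \<in> A'" by auto
  then have "t \<in> {0..dist x y}" by (auto simp: A_def)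
  then have "dist x (c t) + dist y (c t) = dist x y"
    using iso[of 0 t] iso[of t "dist x y"] c by (simp add: dist_commute)
  then have "dist w (c t) \<le> gromov_product w x y + 2 * \<delta>"
    using t double_gromov_product[of w x y] by (simp add: A_def A'_def dist_commute)
  then show ?thesis using c \<open>t \<in> {0..dist x y}\<close> by auto
qed

text \<open>The four-point form of hyperbolicity speaks only of Gromov products, so it applies
  directly to terms of sequences. The constant \<open>k\<close> is kept apart from the thinness
  constant.\<close>

locale gromov_hyperbolic =
  fixes X :: "'x::metric_space itself" and k :: real
  assumes four_point:
    "min (gromov_product w x y) (gromov_product w y z) - k \<le> gromov_product w (x::'x) z"

text \<open>Some point of \<open>[x, z]\<close> realizes the product of \<open>x\<close> and
  \<open>z\<close> up to \<open>2 * \<delta>\<close>. Thinness moves it by another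
  \<open>\<delta>\<close> onto one of the other sides, where the product of the endpoints of that
  side bounds the distance to \<open>w\<close> from below.\<close>

lemma hyperbolic_space_gromov_hyperbolic:
  assumes hyp: "hyperbolic_space TYPE('x::metric_space) \<delta>"
  shows "gromov_hyperbolic TYPE('x) (3 * \<delta>)"
proof
  fix w x y z :: 'x
  obtain S S2 S3 where S: "geodesic_segment x z S" "geodesic_segment z y S2" "geodesic_segment y x S3"
    using hyperbolic_space_segment[OF hyp] by metis
  obtain p where p: "p \<in> S" "dist w p \<le> gromov_product w x z + 2 * \<delta>"
    using hyperbolic_segment_near[OF hyp S(1)] by blast
  obtain q where q: "q \<in> S2 \<union> S3" "dist p q \<le> \<delta>"
    using hyperbolic_space_thin[OF hyp S p(1)] .
  have "min (gromov_product w x y) (gromov_product w y z) \<le> dist w q"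
    using q(1) gromov_product_le_dist_segment[OF S(2), of q w]
      gromov_product_le_dist_segment[OF S(3), of q w]
    by (auto simp: gromov_product_commute)
  also have "\<dots> \<le> dist w p + \<delta>" using dist_triangle[of w q p] q(2) by simp
  finally show "min (gromov_product w x y) (gromov_product w y z) - 3 * \<delta> \<le> gromov_product w x z"
    using p(2) by simp
qed

section \<open>Sequences converging to infinity and boundary points\<close>

lemma converges_to_infinity_iff:
  "converges_to_infinity z \<longleftrightarrow> (\<forall>M. \<exists>N. \<forall>i\<ge>N. \<forall>j\<ge>N. M \<le> gromov_product w (z i) (z j))"
proof
  assume "converges_to_infinity z"
  then have "eventually (\<lambda>(i, j). M \<le> gromov_product w (z i) (z j)) (sequentially \<times>\<^sub>F sequentially)" for M
    unfolding converges_to_infinity_def filterlim_at_top by (simp add: split_def)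
  then show "\<forall>M. \<exists>N. \<forall>i\<ge>N. \<forall>j\<ge>N. M \<le> gromov_product w (z i) (z j)"
    unfolding eventually_prod_sequentially split_def by (simp add: gromov_product_commute)
next
  assume *: "\<forall>M. \<exists>N. \<forall>i\<ge>N. \<forall>j\<ge>N. M \<le> gromov_product w (z i) (z j)"
  show "converges_to_infinity z"
    unfolding converges_to_infinity_def filterlim_at_top
  proof (intro allI)
    fix w' M
    obtain N where "\<forall>i\<ge>N. \<forall>j\<ge>N. M + dist w w' \<le> gromov_product w (z i) (z j)" using * by blast
    then have "\<forall>i\<ge>N. \<forall>j\<ge>N. M \<le> gromov_product w' (z i) (z j)"
      by (meson add_le_cancel_right gromov_product_base order_trans)
    then show "eventually (\<lambda>x. M \<le> (case x of (i, j) \<Rightarrow> gromov_product w' (z i) (z j)))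
        (sequentially \<times>\<^sub>F sequentially)"
      by (auto simp: eventually_prod_sequentially split_def)
  qed
qed

text \<open>A change of base point alters products by at most \<open>dist w w'\<close>, so a single
  base point decides the condition.\<close>

lemma boundary_rel_iff:
  "(z, z') \<in> boundary_rel \<longleftrightarrow> converges_to_infinity z \<and> converges_to_infinity z' \<and>
     (\<forall>M. \<exists>N. \<forall>i\<ge>N. M \<le> gromov_product w (z i) (z' i))"
proof -
  have "filterlim (\<lambda>i. gromov_product w' (z i) (z' i)) at_top sequentially"
    if *: "\<forall>M. \<exists>N. \<forall>i\<ge>N. M \<le> gromov_product w (z i) (z' i)" for w'
    unfolding filterlim_at_top eventually_sequentially
  proof
    fix M
    obtain N where "\<forall>i\<ge>N. M + dist w w' \<le> gromov_product w (z i) (z' i)" using * by blast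
    then show "\<exists>N. \<forall>i\<ge>N. M \<le> gromov_product w' (z i) (z' i)"
      by (meson add_le_cancel_right gromov_product_base order_trans)
  qed
  then show ?thesis
    unfolding boundary_rel_def by (auto simp: filterlim_at_top eventually_sequentially)
qed

lemma converges_to_infinityD:
  "converges_to_infinity z \<Longrightarrow> \<exists>N. \<forall>i\<ge>N. \<forall>j\<ge>N. M \<le> gromov_product w (z i) (z j)"
  using converges_to_infinity_iff[of z w] by blast

lemma boundary_relD:
  "(z, z') \<in> boundary_rel \<Longrightarrow> \<exists>N. \<forall>i\<ge>N. M \<le> gromov_product w (z i) (z' i)"
  using boundary_rel_iff[of z z' w] by blast

context gromov_hyperbolic
begin

lemma four_point':
  "M \<le> gromov_product w x y \<Longrightarrow> M \<le> gromov_product w y z \<Longrightarrow> M - k \<le> gromov_product w (x::'x) z"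
  using four_point[of w x y z] by linarith

text \<open>Equivalence is defined along the diagonal. A four-point step through \<open>z' i\<close>
  separates the two indices, which is needed when information on one sequence is available only at
  sparse indices.\<close>

lemma boundary_rel_strong:
  fixes z z' :: "nat \<Rightarrow> 'x"
  assumes "(z, z') \<in> boundary_rel"
  shows "\<exists>N. \<forall>i\<ge>N. \<forall>j\<ge>N. M \<le> gromov_product w (z i) (z' j)"
proof -
  obtain N1 N2 where N: "\<forall>i\<ge>N1. M + k \<le> gromov_product w (z i) (z' i)"
    "\<forall>i\<ge>N2. \<forall>j\<ge>N2. M + k \<le> gromov_product w (z' i) (z' j)"
    using boundary_relD[OF assms, of "M + k" w] converges_to_infinityD[of z' "M + k" w] assms
    unfolding boundary_rel_def by blast
  then show ?thesis
    using four_point'[of "M + k" w "z i" "z' i" "z' j" for i j]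
    by (intro exI[of _ "max N1 N2"]) auto
qed

lemma equiv_boundary_rel: "equiv {z :: nat \<Rightarrow> 'x. converges_to_infinity z} boundary_rel"
proof (rule equivI)
  show "boundary_rel \<subseteq> {z :: nat \<Rightarrow> 'x. converges_to_infinity z} \<times> {z. converges_to_infinity z}"
    by (auto simp: boundary_rel_def)
  show "refl_on {z :: nat \<Rightarrow> 'x. converges_to_infinity z} boundary_rel"
  proof (rule refl_onI)
    fix z :: "nat \<Rightarrow> 'x" assume "z \<in> {z. converges_to_infinity z}"
    then have z: "converges_to_infinity z" by simp
    fix w :: 'x
    have "\<exists>N. \<forall>i\<ge>N. M \<le> gromov_product w (z i) (z i)" for M
      using z[unfolded converges_to_infinity_iff[of z w]] by meson
    then show "(z, z) \<in> boundary_rel" using z boundary_rel_iff[of z z w] by simp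
  qed
  show "sym (boundary_rel :: ((nat \<Rightarrow> 'x) \<times> (nat \<Rightarrow> 'x)) set)"
    unfolding sym_def boundary_rel_def by (auto simp: gromov_product_commute)
  show "trans (boundary_rel :: ((nat \<Rightarrow> 'x) \<times> (nat \<Rightarrow> 'x)) set)"
  proof (rule transI)
    fix a b c :: "nat \<Rightarrow> 'x" assume ab: "(a, b) \<in> boundary_rel" and bc: "(b, c) \<in> boundary_rel"
    fix w :: 'x
    have "\<exists>N. \<forall>i\<ge>N. M \<le> gromov_product w (a i) (c i)" for M
    proof -
      obtain N1 N2 where "\<forall>i\<ge>N1. M + k \<le> gromov_product w (a i) (b i)"
        "\<forall>i\<ge>N2. M + k \<le> gromov_product w (b i) (c i)"
        using boundary_relD[OF ab, of "M + k" w] boundary_relD[OF bc, of "M + k" w] by blast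
      then show ?thesis
        using four_point'[of "M + k" w "a i" "b i" "c i" for i]
        by (intro exI[of _ "max N1 N2"]) auto
    qed
    then show "(a, c) \<in> boundary_rel"
      using ab bc unfolding boundary_rel_iff[of a c w] by (auto simp: boundary_rel_def)
  qed
qed

lemma boundary_point:
  fixes \<xi> :: "(nat \<Rightarrow> 'x) set"
  assumes "\<xi> \<in> gromov_boundary"
  shows boundary_point_nonempty: "\<exists>z. z \<in> \<xi>"
    and boundary_point_converges: "z \<in> \<xi> \<Longrightarrow> converges_to_infinity z"
    and boundary_point_rel: "z \<in> \<xi> \<Longrightarrow> z' \<in> \<xi> \<longleftrightarrow> (z, z') \<in> boundary_rel"
    and boundary_point_class: "z \<in> \<xi> \<Longrightarrow> \<xi> = boundary_rel `` {z}"
proof -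
  obtain z0 where z0: "converges_to_infinity z0" "\<xi> = boundary_rel `` {z0}"
    using assms unfolding gromov_boundary_def quotient_def by auto
  show "\<exists>z. z \<in> \<xi>" using z0 equiv_class_self[OF equiv_boundary_rel] by auto
  show "z \<in> \<xi> \<Longrightarrow> converges_to_infinity z" using z0 by (auto simp: boundary_rel_def)
  show cl: "z \<in> \<xi> \<Longrightarrow> \<xi> = boundary_rel `` {z}"
    using z0 equiv_class_eq[OF equiv_boundary_rel] by auto
  show "z \<in> \<xi> \<Longrightarrow> z' \<in> \<xi> \<longleftrightarrow> (z, z') \<in> boundary_rel" using cl by auto
qed

lemma boundary_product_le:
  assumes "z \<in> \<xi>" "z' \<in> \<xi>'" "eventually (\<lambda>i. gromov_product w (z i) (z' i :: 'x) \<le> M) sequentially"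
  shows "boundary_product w \<xi> \<xi>' \<le> ereal M"
proof -
  have "boundary_product w \<xi> \<xi>' \<le> liminf (\<lambda>i. ereal (gromov_product w (z i) (z' i)))"
    unfolding boundary_product_def using assms by (intro INF_lower2[of "(z, z')"]) auto
  also have "\<dots> \<le> liminf (\<lambda>i. ereal M)" by (rule Liminf_mono) (use assms in auto)
  finally show ?thesis by (simp add: Liminf_const)
qed

text \<open>The boundary product is an infimum over all representatives, but exchanging one
  representative costs at most \<open>k\<close>. One pair of sequences therefore bounds it from
  below.\<close>

lemma boundary_product_ge:
  fixes \<xi> \<xi>' :: "(nat \<Rightarrow> 'x) set"
  assumes "\<xi> \<in> gromov_boundary" "\<xi>' \<in> gromov_boundary" "z \<in> \<xi>" "z' \<in> \<xi>'"
    and ev: "eventually (\<lambda>i. M \<le> gromov_product w (z i) (z' i)) sequentially"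
  shows "ereal (M - 2 * k) \<le> boundary_product w \<xi> \<xi>'"
  unfolding boundary_product_def
proof (rule INF_greatest, clarsimp)
  fix y y' assume y: "y \<in> \<xi>" "y' \<in> \<xi>'"
  have r: "(y, z) \<in> boundary_rel" "(z', y') \<in> boundary_rel"
    using assms y boundary_point_rel by blast+
  have "eventually (\<lambda>i. M - 2 * k \<le> gromov_product w (y i) (y' i)) sequentially"
  proof -
    obtain N1 N2 where N: "\<forall>i\<ge>N1. M \<le> gromov_product w (y i) (z i)"
      "\<forall>i\<ge>N2. M - k \<le> gromov_product w (z' i) (y' i)"
      using boundary_relD[OF r(1), of M w] boundary_relD[OF r(2), of "M - k" w] by blast
    from ev obtain N3 where N3: "\<forall>i\<ge>N3. M \<le> gromov_product w (z i) (z' i)"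
      by (auto simp: eventually_sequentially)
    show ?thesis
      unfolding eventually_sequentially
    proof (intro exI[of _ "max N1 (max N2 N3)"] allI impI)
      fix i assume "max N1 (max N2 N3) \<le> i"
      then show "M - 2 * k \<le> gromov_product w (y i) (y' i)"
        using four_point'[of M w "y i" "z i" "z' i"]
          four_point'[of "M - k" w "y i" "z' i" "y' i"] N N3 by auto
    qed
  qed
  then have "liminf (\<lambda>i. ereal (M - 2 * k)) \<le> liminf (\<lambda>i. ereal (gromov_product w (y i) (y' i)))"
    by (intro Liminf_mono) auto
  then show "ereal (M - 2 * k) \<le> liminf (\<lambda>i. ereal (gromov_product w (y i) (y' i)))" by (simp add: Liminf_const)
qed

text \<open>Distinct points have representatives \<open>y\<close>, \<open>y'\<close> whose product
  stays below some \<open>M\<close> infinitely often; any other pair is compared with them at one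
  such index, at cost \<open>k\<close> per exchange. The bound is uniform over representatives, so
  it can later be applied to the translates of a sequence by all stabilizer elements at
  once.\<close>

lemma boundary_product_finite:
  fixes \<xi> \<xi>' :: "(nat \<Rightarrow> 'x) set"
  assumes b: "\<xi> \<in> gromov_boundary" "\<xi>' \<in> gromov_boundary" and ne: "\<xi> \<noteq> \<xi>'"
  shows "\<exists>M. \<forall>z\<in>\<xi>. \<forall>z'\<in>\<xi>'. eventually (\<lambda>i. gromov_product w (z i) (z' i) \<le> M) sequentially"
proof -
  obtain y y' where y: "y \<in> \<xi>" "y' \<in> \<xi>'" using b boundary_point_nonempty by blast
  have "(y, y') \<notin> boundary_rel" using y b ne boundary_point_rel boundary_point_class by blast
  then obtain M where M: "\<forall>N. \<exists>i\<ge>N. gromov_product w (y i) (y' i) < M"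
    using b y boundary_point_converges boundary_rel_iff[of y y' w] by (meson not_le)
  show ?thesis
  proof (intro exI[of _ "M + 2 * k"] ballI)
    fix z z' assume z: "z \<in> \<xi>" "z' \<in> \<xi>'"
    then have r: "(y, z) \<in> boundary_rel" "(z', y') \<in> boundary_rel"
      using b y boundary_point_rel by blast+
    obtain N1 N2 where N: "\<forall>i\<ge>N1. \<forall>j\<ge>N1. M + 2 * k \<le> gromov_product w (y i) (z j)"
      "\<forall>i\<ge>N2. \<forall>j\<ge>N2. M + k \<le> gromov_product w (z' i) (y' j)"
      using boundary_rel_strong[OF r(1), of "M + 2 * k" w] boundary_rel_strong[OF r(2), of "M + k" w]
      by blast
    obtain j where j: "j \<ge> max N1 N2" "gromov_product w (y j) (y' j) < M" using M by blast
    have "gromov_product w (z i) (z' i) \<le> M + 2 * k" if "i \<ge> max N1 N2" for i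
      using four_point'[of "M + 2 * k" w "y j" "z i" "z' i"]
        four_point'[of "M + k" w "y j" "z' i" "y' j"] N j that by force
    then show "eventually (\<lambda>i. gromov_product w (z i) (z' i) \<le> M + 2 * k) sequentially"
      unfolding eventually_sequentially by blast
  qed
qed

end

section \<open>Geodesic rays towards boundary points\<close>

lemma geodesic_ray_dist:
  assumes "geodesic_ray c x" "0 \<le> s" "0 \<le> t"
  shows "dist (c s) (c t) = \<bar>s - t\<bar>" "dist x (c t) = t"
  using assms unfolding geodesic_ray_def by force+

lemma geodesic_ray_segment:
  assumes "geodesic_ray c x" "0 \<le> t"
  shows "geodesic_segment x (c t) (c ` {0..t})"
proof -
  have "dist x (c t) = t" using geodesic_ray_dist assms by blast
  then show ?thesis
    using assms unfolding geodesic_segment_def geodesic_ray_def by (intro exI[of _ c]) auto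
qed

lemma geodesic_ray_converges:
  assumes "geodesic_ray c x"
  shows "converges_to_infinity (\<lambda>n. c (real n))"
proof -
  have "gromov_product x (c (real i)) (c (real j)) = min (real i) (real j)" for i j
    using double_gromov_product[of x "c (real i)" "c (real j)"]
      geodesic_ray_dist[OF assms, of "real i" "real j"] geodesic_ray_dist[OF assms, of "real j" "real i"]
    by (simp add: dist_commute min_def abs_if split: if_splits)
  moreover have "\<exists>N. \<forall>i\<ge>N. \<forall>j\<ge>N. M \<le> min (real i) (real j)" for M
  proof -
    obtain N where "M \<le> real N" using real_arch_simple by blast
    then show ?thesis by (intro exI[of _ N]) auto
  qed
  ultimately show ?thesis by (simp add: converges_to_infinity_iff[of _ x])
qed

text \<open>The ray is a cluster point, in the compact product of balls, of geodesics from \<open>x\<close> to the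
  terms of a sequence converging to \<open>\<xi>\<close>.\<close>

lemma (in gromov_hyperbolic) geodesic_ray_to_exists:
  fixes x :: 'x
  assumes proper: "proper_space TYPE('x)"
    and geo: "\<And>x y :: 'x. \<exists>S. geodesic_segment x y S" and \<xi>: "\<xi> \<in> gromov_boundary"
  shows "\<exists>c. geodesic_ray_to c x \<xi>"
proof -
  obtain z where z: "z \<in> \<xi>" "converges_to_infinity z"
    using boundary_point_nonempty[OF \<xi>] boundary_point_converges[OF \<xi>] by blast
  have "\<exists>e. e 0 = x \<and> (\<forall>s\<in>{0..dist x (z n)}. \<forall>t\<in>{0..dist x (z n)}. dist (e s) (e t) = \<bar>s - t\<bar>)
      \<and> e (dist x (z n)) = z n" for n
    using geo[of x "z n"] unfolding geodesic_segment_def by blast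
  then obtain e where e0: "\<And>n. e n 0 = x"
    and e: "\<And>n s t. \<lbrakk>s \<in> {0..dist x (z n)}; t \<in> {0..dist x (z n)}\<rbrakk> \<Longrightarrow> dist (e n s) (e n t) = \<bar>s - t\<bar>"
    and e1: "\<And>n. e n (dist x (z n)) = z n"
    by metis
  \<comment> \<open>Clamping the parameter makes every finite geodesic a function on the whole line,
    hence a point of one fixed product of balls.\<close>
  define d where "d n t = e n (max 0 (min t (dist x (z n))))" for n t
  have far: "\<exists>N. \<forall>n\<ge>N. M \<le> dist x (z n)" for M
    using converges_to_infinityD[OF z(2), of M x] by (metis gromov_product_self)
  define K where "K = (\<Pi>\<^sub>E t\<in>UNIV. cball x \<bar>t\<bar>)"
  have "compact K"
    using proper compactin_PiE[of "\<lambda>t::real. euclidean :: 'x topology" UNIV "\<lambda>t. cball x \<bar>t\<bar>"]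
    unfolding K_def proper_space_def by (simp add: euclidean_product_topology)
  have dx: "dist x (d n t) \<le> \<bar>t\<bar>" for n t
    using e[of 0 n "max 0 (min t (dist x (z n)))"] by (simp add: d_def e0)
  then have dK: "d n \<in> K" for n by (auto simp: K_def)
  \<comment> \<open>An uncountable product of compact spaces need not be sequentially compact, so a
    cluster point of the filter takes the place of a convergent subsequence.\<close>
  have "filtermap d sequentially \<le> principal K" "filtermap d sequentially \<noteq> bot"
    by (simp_all add: le_principal eventually_filtermap dK filtermap_bot_iff)
  with \<open>compact K\<close>[unfolded compact_filter, rule_format]
  obtain c where "c \<in> K" and c: "inf (nhds c) (filtermap d sequentially) \<noteq> bot"
    by (auto simp: le_principal)
  have cluster: "\<exists>n\<ge>N. d n \<in> V" if "open V" "c \<in> V" for V N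
  proof (rule ccontr)
    assume "\<not> ?thesis"
    then have "eventually (\<lambda>f. f \<notin> V) (filtermap d sequentially)"
      by (auto simp: eventually_filtermap eventually_sequentially)
    moreover have "eventually (\<lambda>f. f \<in> V) (nhds c)" using that by (auto simp: eventually_nhds)
    ultimately have "eventually (\<lambda>f. False) (inf (nhds c) (filtermap d sequentially))"
      unfolding eventually_inf by (intro exI conjI) auto
    then show False using c by (simp add: eventually_False)
  qed
  have near: "\<exists>n\<ge>N. dist (d n s) (c s) < r \<and> dist (d n t) (c t) < r" if "r > 0" for s t r N
  proof -
    have "open {f :: real \<Rightarrow> 'x. dist (f s) (c s) < r \<and> dist (f t) (c t) < r}"
      by (intro open_Collect_conj open_Collect_less continuous_intros continuous_on_product_coordinates)
    then show ?thesis using cluster[of _ N] that by fastforce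
  qed
  have "dist x (c 0) \<le> 0" using \<open>c \<in> K\<close> by (auto simp: K_def PiE_iff dest: spec[of _ 0])
  then have "c 0 = x" by simp
  have iso: "dist (c s) (c t) = \<bar>s - t\<bar>" if st: "0 \<le> s" "0 \<le> t" for s t
  proof (rule ccontr)
    assume ne: "\<not> ?thesis"
    define r where "r = \<bar>dist (c s) (c t) - \<bar>s - t\<bar>\<bar> / 2"
    have "r > 0" using ne by (simp add: r_def)
    obtain N where N: "\<forall>n\<ge>N. max s t \<le> dist x (z n)" using far by blast
    obtain n where n: "n \<ge> N" "dist (d n s) (c s) < r" "dist (d n t) (c t) < r"
      using near[OF \<open>r > 0\<close>] by blast
    have "dist (d n s) (d n t) = \<bar>s - t\<bar>"
      using e[of s n t] N n st unfolding d_def by (auto simp: min_absorb1 max_absorb2)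
    then have "\<bar>dist (c s) (c t) - \<bar>s - t\<bar>\<bar> < 2 * r"
      using n dist_triangle[of "c s" "c t" "d n s"] dist_triangle[of "d n s" "c t" "d n t"]
        dist_triangle[of "d n s" "d n t" "c s"] dist_triangle[of "c s" "d n t" "c t"]
      by (simp add: dist_commute)
    then show False by (simp add: r_def)
  qed
  have ray: "geodesic_ray c x" using \<open>c 0 = x\<close> iso by (simp add: geodesic_ray_def)
  have "(z, \<lambda>n. c (real n)) \<in> boundary_rel"
    unfolding boundary_rel_iff[of z "\<lambda>n. c (real n)" x]
  proof (intro conjI allI z geodesic_ray_converges[OF ray])
    fix M
    obtain N1 where N1: "\<forall>i\<ge>N1. \<forall>j\<ge>N1. M + k \<le> gromov_product x (z i) (z j)"
      using converges_to_infinityD[OF z(2)] by blast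
    obtain N2 where N2: "M + k + 1 \<le> real N2" using real_arch_simple by blast
    \<comment> \<open>The point \<open>d n (real m)\<close> lies on the geodesic to
      \<open>z n\<close>, so its product with \<open>z n\<close> is exactly \<open>m\<close>. The
      \<open>+ 1\<close> in the choice of \<open>N2\<close> pays for passing to
      \<open>c (real m)\<close>, and a four-point step through \<open>z n\<close> reaches
      \<open>z m\<close>.\<close>
    have "M \<le> gromov_product x (z m) (c (real m))" if m: "m \<ge> max N1 N2" for m
    proof -
      obtain N where N: "\<forall>n\<ge>N. real m \<le> dist x (z n)" using far by blast
      obtain n where n: "n \<ge> max N N1" "dist (d n (real m)) (c (real m)) < 1"
        using near[of 1] by (metis zero_less_one)
      have le: "real m \<le> dist x (z n)" using N n by simp
      then have dm: "d n (real m) = e n (real m)" by (simp add: d_def)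
      have "gromov_product x (d n (real m)) (z n) = real m"
        using double_gromov_product[of x "d n (real m)" "z n"] e[of 0 n "real m"]
          e[of "real m" n "dist x (z n)"] le
        by (simp add: dm e0 e1 dist_commute)
      then have "M + k \<le> gromov_product x (z n) (c (real m))"
        using gromov_product_perturb[of x "d n (real m)" "z n" "c (real m)"] n N2 m
        by (simp add: gromov_product_commute)
      moreover have "M + k \<le> gromov_product x (z m) (z n)" using N1 m n by simp
      ultimately show ?thesis using four_point'[of "M + k" x "z m" "z n"] by simp
    qed
    then show "\<exists>N. \<forall>i\<ge>N. M \<le> gromov_product x (z i) (c (real i))" by blast
  qed
  then have "(\<lambda>n. c (real n)) \<in> \<xi>" using boundary_point_rel[OF \<xi> z(1)] by blast
  then show ?thesis using ray unfolding geodesic_ray_to_def by blast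
qed

text \<open>The argument gives \<open>2 * \<delta>\<close>; \<open>5 * \<delta>\<close> is the constant in the definition of a horofunction.\<close>

lemma asymptotic_rays:
  fixes x y :: "'x::metric_space"
  assumes hyp: "hyperbolic_space TYPE('x) \<delta>" and \<xi>: "\<xi> \<in> gromov_boundary"
    and c: "geodesic_ray_to c x \<xi>" and c': "geodesic_ray_to c' y \<xi>"
  shows "\<exists>T\<ge>0. \<forall>t\<ge>T. infdist (c t) (c' ` {0..}) \<le> 5 * \<delta>"
proof -
  interpret gromov_hyperbolic "TYPE('x)" "3 * \<delta>"
    by (rule hyperbolic_space_gromov_hyperbolic[OF hyp])
  have d0: "0 \<le> \<delta>" using hyperbolic_space_nonneg[OF hyp] .
  have r: "geodesic_ray c x" "geodesic_ray c' y" using c c' by (auto simp: geodesic_ray_to_def)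
  have rel: "((\<lambda>n. c (real n)), (\<lambda>n. c' (real n))) \<in> boundary_rel"
    using c c' boundary_point_rel[OF \<xi>] by (auto simp: geodesic_ray_to_def)
  \<comment> \<open>A diagonal cuts the quadrilateral on \<open>x\<close>, \<open>y\<close>,
    \<open>c n\<close>, \<open>c' n\<close> into two thin triangles. The bound on \<open>t\<close>
    puts \<open>c t\<close> out of reach of \<open>[x, y]\<close>, and a large \<open>n\<close> puts
    it out of reach of \<open>[c n, c' n]\<close>. What remains is the other ray.\<close>
  have "infdist (c t) (c' ` {0..}) \<le> 5 * \<delta>" if t: "t \<ge> dist x y + 2 * \<delta> + 1" for t
  proof -
    have t0: "0 \<le> t" using t d0 zero_le_dist[of x y] by linarith
    obtain N where N: "\<forall>n\<ge>N. t + 2 * \<delta> + 1 \<le> gromov_product x (c (real n)) (c' (real n))"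
      using boundary_relD[OF rel] by blast
    obtain n where n: "n \<ge> N" "t \<le> real n"
      using real_arch_simple[of t] by (metis linear of_nat_le_iff order_trans)
    obtain S2 S3 S4 where S: "geodesic_segment (c (real n)) (c' (real n)) S2"
      "geodesic_segment (c' (real n)) x S3" "geodesic_segment x y S4"
      using hyperbolic_space_segment[OF hyp] by metis
    have "c t \<in> c ` {0..real n}" using n t0 by auto
    then obtain q where q: "q \<in> S2 \<union> S3" "dist (c t) q \<le> \<delta>"
      using hyperbolic_space_thin[OF hyp geodesic_ray_segment[OF r(1)] S(1,2)] by (metis of_nat_0_le_iff)
    have xt: "dist x (c t) = t" using geodesic_ray_dist[OF r(1)] t0 by blast
    have "q \<notin> S2"
    proof
      assume "q \<in> S2"
      then have "t + 2 * \<delta> + 1 \<le> dist x q"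
        using gromov_product_le_dist_segment[OF S(1)] N n(1) by (meson order_trans)
      then show False using dist_triangle[of x q "c t"] q(2) xt d0 by linarith
    qed
    then have "q \<in> S3" using q by blast
    then obtain p where p: "p \<in> S4 \<union> c' ` {0..real n}" "dist q p \<le> \<delta>"
      using hyperbolic_space_thin[OF hyp S(2,3) geodesic_ray_segment[OF r(2)]] by (metis of_nat_0_le_iff)
    have ctp: "dist (c t) p \<le> 2 * \<delta>" using dist_triangle[of "c t" p q] p(2) q(2) by linarith
    have "p \<notin> S4"
    proof
      assume "p \<in> S4"
      then have "dist x p \<le> dist x y" using geodesic_segment_dist[OF S(3)] by blast
      then show False using dist_triangle[of x "c t" p] ctp xt t by (simp add: dist_commute)
    qed
    then have "p \<in> c' ` {0..}" using p by auto
    then show ?thesis using infdist_le2[of p "c' ` {0..}" "c t" "5 * \<delta>"] ctp d0 by simp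
  qed
  then show ?thesis using d0 by (intro exI[of _ "dist x y + 2 * \<delta> + 1"]) auto
qed

section \<open>Isometric actions and the boundary\<close>

locale isometric_group_action = group G
  for G :: "('g, 'm) monoid_scheme" (structure) +
  fixes act :: "'g \<Rightarrow> 'x::metric_space \<Rightarrow> 'x"
  assumes isometric: "isometric_action G act"
begin

lemma action: "group_action G UNIV act"
  using isometric by (simp add: isometric_action_def)

lemma act_mult: "g \<in> carrier G \<Longrightarrow> h \<in> carrier G \<Longrightarrow> act (g \<otimes> h) x = act g (act h x)"
  using group_action.composition_rule[OF action] by simp

lemma act_one [simp]: "act \<one> x = x"
  using fun_cong[OF group_action.id_eq_one[OF action], of x] by simp

lemma act_inv [simp]:
  assumes "g \<in> carrier G"
  shows "act (inv g) (act g x) = x" "act g (act (inv g) x) = x"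
  using assms by (simp_all flip: act_mult)

lemma act_dist [simp]: "g \<in> carrier G \<Longrightarrow> dist (act g x) (act g y) = dist x y"
  using isometric by (simp add: isometric_action_def)

lemma act_dist_left: "g \<in> carrier G \<Longrightarrow> dist (act g x) y = dist x (act (inv g) y)"
  using act_dist[of g x "act (inv g) y"] by simp

lemma gromov_product_act [simp]:
  "g \<in> carrier G \<Longrightarrow> gromov_product (act g w) (act g x) (act g y) = gromov_product w x y"
  by (simp add: gromov_product_def)

lemma converges_to_infinity_act:
  assumes "g \<in> carrier G" "converges_to_infinity z"
  shows "converges_to_infinity (act g \<circ> z)"
  using assms(2) unfolding converges_to_infinity_iff[of z w]
    converges_to_infinity_iff[of "act g \<circ> z" "act g w"]
  by (simp add: assms(1))

lemma boundary_rel_act: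
  assumes "g \<in> carrier G" "(z, z') \<in> boundary_rel"
  shows "(act g \<circ> z, act g \<circ> z') \<in> boundary_rel"
  using assms(2) unfolding boundary_rel_iff[of z z' w] boundary_rel_iff[of "act g \<circ> z" _ "act g w"]
  by (simp add: assms(1) converges_to_infinity_act)

lemma boundary_act_mult:
  "g \<in> carrier G \<Longrightarrow> h \<in> carrier G \<Longrightarrow>
    boundary_act act (g \<otimes> h) \<xi> = boundary_act act g (boundary_act act h \<xi>)"
  unfolding boundary_act_def image_image by (intro image_cong refl) (auto simp: act_mult)

lemma boundary_act_one [simp]: "boundary_act act \<one> \<xi> = \<xi>"
proof -
  have "(\<circ>) (act \<one>) = (\<lambda>z :: nat \<Rightarrow> 'x. z)" by (simp add: fun_eq_iff)
  then show ?thesis by (simp add: boundary_act_def)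
qed

lemma boundary_act_inv [simp]:
  assumes "g \<in> carrier G"
  shows "boundary_act act (inv g) (boundary_act act g \<xi>) = \<xi>"
    "boundary_act act g (boundary_act act (inv g) \<xi>) = \<xi>"
  using assms by (simp_all flip: boundary_act_mult)

text \<open>The action moves sequences one by one; that the image fills a whole equivalence class
  uses the inverse element.\<close>

lemma boundary_act_in_boundary:
  assumes g: "g \<in> carrier G" and "\<xi> \<in> gromov_boundary"
  shows "boundary_act act g \<xi> \<in> gromov_boundary"
proof -
  obtain z where z: "converges_to_infinity z" "\<xi> = boundary_rel `` {z}"
    using assms(2) unfolding gromov_boundary_def quotient_def by auto
  have "y \<in> boundary_act act g \<xi>" if "(act g \<circ> z, y) \<in> boundary_rel" for y
  proof -
    have "act (inv g) \<circ> (act g \<circ> z) = z" "act g \<circ> (act (inv g) \<circ> y) = y" using g by auto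
    then have "act (inv g) \<circ> y \<in> \<xi>" "y = act g \<circ> (act (inv g) \<circ> y)"
      using boundary_rel_act[OF _ that, of "inv g"] g z(2) by auto
    then show ?thesis unfolding boundary_act_def by blast
  qed
  then have "boundary_act act g \<xi> = boundary_rel `` {act g \<circ> z}"
    using boundary_rel_act[OF g] z(2) by (auto simp: boundary_act_def)
  moreover have "converges_to_infinity (act g \<circ> z)" using converges_to_infinity_act[OF g z(1)] .
  ultimately show ?thesis by (auto simp: gromov_boundary_def intro: quotientI)
qed

lemma geodesic_ray_to_act:
  assumes "g \<in> carrier G" "geodesic_ray_to c x \<xi>"
  shows "geodesic_ray_to (act g \<circ> c) (act g x) (boundary_act act g \<xi>)"
  using assms unfolding geodesic_ray_to_def geodesic_ray_def boundary_act_def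
  by (auto intro!: image_eqI[of _ _ "\<lambda>n. c (real n)"])

lemma stabilizer_boundary:
  assumes "p \<in> stabilizer G (boundary_act act) \<xi>"
  shows "p \<in> carrier G" "boundary_act act p \<xi> = \<xi>" "inv p \<in> stabilizer G (boundary_act act) \<xi>"
proof -
  show p: "p \<in> carrier G" "boundary_act act p \<xi> = \<xi>" using assms by (auto simp: stabilizer_def)
  then show "inv p \<in> stabilizer G (boundary_act act) \<xi>"
    using boundary_act_inv(1)[of p \<xi>] by (simp add: stabilizer_def)
qed

lemma parabolic_points_subset_boundary: "parabolic_points G act \<subseteq> gromov_boundary"
  by (auto simp: parabolic_points_def parabolic_at_def orbit_accumulation_points_def)

end

section \<open>Parabolic displacement and the visual metric\<close>

locale cusp_uniform =
  fixes \<delta> :: real and G :: "('g, 'm) monoid_scheme" (structure) and \<P> :: "'g set set"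
    and act :: "'g \<Rightarrow> 'x::metric_space \<Rightarrow> 'x" and B :: "(nat \<Rightarrow> 'x) set \<Rightarrow> 'x set"
  assumes cusp_uniform: "cusp_uniform_action_with \<delta> G \<P> act B"
begin

lemma hyperbolic: "hyperbolic_space TYPE('x) \<delta>"
  and proper: "proper_space TYPE('x)"
  and discontinuous: "properly_discontinuous G act"
  and conjugacy: "conjugacy_representatives G (maximal_parabolic_subgroups G act) \<P>"
  and horoballs: "cusp_uniform_horoballs \<delta> G act B"
  using cusp_uniform by (simp_all add: cusp_uniform_action_with_def)

end

sublocale cusp_uniform \<subseteq> isometric_group_action G act
  using cusp_uniform
  by (simp add: isometric_group_action_def isometric_group_action_axioms_def
      cusp_uniform_action_with_def group_pair_def)

sublocale cusp_uniform \<subseteq> gromov_hyperbolic "TYPE('x)" "3 * \<delta>"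
  by (rule hyperbolic_space_gromov_hyperbolic[OF hyperbolic])

context cusp_uniform
begin

abbreviation stab :: "(nat \<Rightarrow> 'x) set \<Rightarrow> 'g set" where
  "stab \<xi> \<equiv> stabilizer G (boundary_act act) \<xi>"

lemma delta_nonneg: "0 \<le> \<delta>"
  using hyperbolic_space_nonneg[OF hyperbolic] .

lemma ray_exists:
  fixes x :: 'x
  shows "\<xi> \<in> gromov_boundary \<Longrightarrow> \<exists>c. geodesic_ray_to c x \<xi>"
  by (rule geodesic_ray_to_exists[OF proper]) (use hyperbolic_space_segment[OF hyperbolic] in metis)

text \<open>An element of the stabilizer changes the horofunction by a constant, up to a bounded error.
  The horoball is invariant, so that constant is bounded.\<close>

lemma stabilizer_busemann_bounded:
  assumes \<xi>: "\<xi> \<in> parabolic_points G act" and y: "y \<in> B \<xi>" and c: "geodesic_ray_to c y \<xi>"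
  shows "\<exists>C. \<forall>p\<in>stab \<xi>. \<exists>T. \<forall>t\<ge>T. \<bar>dist (act p y) (c t) - dist y (c t)\<bar> \<le> C"
proof -
  have b: "\<xi> \<in> gromov_boundary" using \<xi> parabolic_points_subset_boundary by blast
  obtain h D where h: "B \<xi> = h -` {0<..}"
    and D: "\<And>x w c. geodesic_ray_to c x \<xi> \<Longrightarrow> infdist w (c ` {0..}) \<le> 5 * \<delta> \<Longrightarrow>
       \<bar>h w - h x - dist x w\<bar> \<le> D"
    using horoballs \<xi> unfolding cusp_uniform_horoballs_def open_horoball_def horofunction_def by metis
  \<comment> \<open>Far out, the ray \<open>e\<close> runs within \<open>5 * \<delta>\<close> of
    \<open>e'\<close>, so the horofunction estimate based at \<open>x\<close> also applies to points
    of \<open>e\<close>.\<close>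
  have near: "\<exists>T\<ge>0. \<forall>t\<ge>T. \<bar>h (e t) - h x - dist x (e t)\<bar> \<le> D"
    if "geodesic_ray_to e x' \<xi>" "geodesic_ray_to e' x \<xi>" for e e' x x'
    using asymptotic_rays[OF hyperbolic b that] D[OF that(2)] by blast
  have ray: "geodesic_ray_to (act p \<circ> c) (act p y) \<xi>" if "p \<in> stab \<xi>" for p
    using geodesic_ray_to_act[OF _ c, of p] stabilizer_boundary[OF that] by simp
  have pos: "h (act p y) > 0" if "p \<in> stab \<xi>" for p
  proof -
    have "B \<xi> = act p ` B \<xi>"
      using stabilizer_boundary[OF that] horoballs \<xi> unfolding cusp_uniform_horoballs_def by metis
    then show ?thesis using y h by blast
  qed
  have up: "\<exists>T. \<forall>t\<ge>T. \<bar>dist (act p y) (c t) - dist y (c t) - (h y - h (act p y))\<bar> \<le> 2 * D"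
    if p: "p \<in> stab \<xi>" for p
  proof -
    obtain T1 T2 where "\<forall>t\<ge>T1. \<bar>h (c t) - h y - dist y (c t)\<bar> \<le> D"
      "\<forall>t\<ge>T2. \<bar>h (c t) - h (act p y) - dist (act p y) (c t)\<bar> \<le> D"
      using near[OF c c] near[OF c ray[OF p]] by blast
    then have "\<forall>t\<ge>max T1 T2. \<bar>dist (act p y) (c t) - dist y (c t) - (h y - h (act p y))\<bar> \<le> 2 * D"
      by (smt (verit) max.bounded_iff)
    then show ?thesis by blast
  qed
  \<comment> \<open>Comparing along the translated ray shows that the change of \<open>h\<close>
    from \<open>y\<close> to \<open>act p y\<close> is, up to \<open>4 * D\<close>, minus its change
    from \<open>y\<close> to \<open>act (inv p) y\<close>. Positivity of \<open>h\<close> at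
    \<open>act (inv p) y\<close> then bounds it above, as positivity at \<open>act p y\<close>
    bounds it below.\<close>
  have low: "h (act p y) - h y \<le> h y + 4 * D" if p: "p \<in> stab \<xi>" for p
  proof -
    obtain T1 T2 T3 where T: "\<forall>t\<ge>T1. \<bar>h (act p (c t)) - h y - dist y (act p (c t))\<bar> \<le> D"
      "\<forall>t\<ge>T2. \<bar>h (act p (c t)) - h (act p y) - dist (act p y) (act p (c t))\<bar> \<le> D"
      "\<forall>t\<ge>T3. \<bar>dist (act (inv p) y) (c t) - dist y (c t) - (h y - h (act (inv p) y))\<bar> \<le> 2 * D"
      using near[OF ray[OF p] c] near[OF ray[OF p] ray[OF p]] up[OF stabilizer_boundary(3)[OF p]]
      by (metis comp_apply)
    define t where "t = max T1 (max T2 T3)"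
    have "dist (act (inv p) y) (c t) = dist y (act p (c t))"
      using act_dist_left[of "inv p" y "c t"] stabilizer_boundary[OF p] by simp
    moreover have "T1 \<le> t" "T2 \<le> t" "T3 \<le> t" by (auto simp: t_def)
    moreover have "dist (act p y) (act p (c t)) = dist y (c t)" using stabilizer_boundary[OF p] by simp
    ultimately show ?thesis
      using T[rule_format, of t] pos[OF stabilizer_boundary(3)[OF p]] by linarith
  qed
  show ?thesis
  proof (rule exI[of _ "\<bar>h y\<bar> + 6 * \<bar>D\<bar>"], rule ballI)
    fix p assume p: "p \<in> stab \<xi>"
    obtain T where "\<forall>t\<ge>T. \<bar>dist (act p y) (c t) - dist y (c t) - (h y - h (act p y))\<bar> \<le> 2 * D"
      using up[OF p] by blast
    then have "\<bar>dist (act p y) (c t) - dist y (c t)\<bar> \<le> \<bar>h y\<bar> + 6 * \<bar>D\<bar>" if "t \<ge> T" for t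
      using low[OF p] pos[OF p] that by (smt (verit))
    then show "\<exists>T. \<forall>t\<ge>T. \<bar>dist (act p y) (c t) - dist y (c t)\<bar> \<le> \<bar>h y\<bar> + 6 * \<bar>D\<bar>" by blast
  qed
qed

text \<open>The geodesic from \<open>\<xi>\<close> to \<open>p \<zeta>\<close> passes near the midpoint of the segment from \<open>y\<close> to \<open>p y\<close>.\<close>

lemma stabilizer_gromov_product:
  assumes \<xi>: "\<xi> \<in> parabolic_points G act" and y: "y \<in> B \<xi>"
    and \<zeta>: "\<zeta> \<in> gromov_boundary" "\<zeta> \<noteq> \<xi>"
  shows "\<exists>u\<in>\<xi>. \<exists>v\<in>\<zeta>. \<exists>C. \<forall>p\<in>stab \<xi>. eventually (\<lambda>i.
    \<bar>gromov_product y (u i) (act p (v i)) - dist y (act p y) / 2\<bar> \<le> C) sequentially"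
proof -
  have b: "\<xi> \<in> gromov_boundary" using \<xi> parabolic_points_subset_boundary by blast
  obtain c where c: "geodesic_ray_to c y \<xi>" using ray_exists[OF b] by blast
  define u where "u i = c (real i)" for i
  have u: "u \<in> \<xi>" using c by (simp add: u_def[abs_def] geodesic_ray_to_def)
  obtain v where v: "v \<in> \<zeta>" using boundary_point_nonempty[OF \<zeta>(1)] by blast
  obtain M where M: "\<And>z z'. z \<in> \<xi> \<Longrightarrow> z' \<in> \<zeta> \<Longrightarrow>
      eventually (\<lambda>i. gromov_product y (z i) (z' i) \<le> M) sequentially"
    using boundary_product_finite[OF b \<zeta>(1), of y] \<zeta>(2) by blast
  obtain C0 where C0: "\<And>p. p \<in> stab \<xi> \<Longrightarrow>
      \<exists>T. \<forall>t\<ge>T. \<bar>dist (act p y) (c t) - dist y (c t)\<bar> \<le> C0"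
    using stabilizer_busemann_bounded[OF \<xi> y c] by blast
  have C: "eventually (\<lambda>i. \<bar>dist (act p y) (u i) - dist y (u i)\<bar> \<le> C0) sequentially"
    if p: "p \<in> stab \<xi>" for p
  proof -
    obtain T where "\<forall>t\<ge>T. \<bar>dist (act p y) (c t) - dist y (c t)\<bar> \<le> C0" using C0[OF p] by blast
    moreover have "eventually (\<lambda>i. real i \<ge> T) sequentially"
      using filterlim_real_sequentially by (simp add: filterlim_at_top)
    ultimately show ?thesis unfolding u_def by (auto elim: eventually_mono)
  qed
  define k where "k = 3 * \<delta>"
  have k0: "0 \<le> k" using delta_nonneg by (simp add: k_def)
  define M' where "M' = 2 * (M + k) + C0"
  have "eventually (\<lambda>i. \<bar>gromov_product y (u i) (act p (v i)) - dist y (act p y) / 2\<bar>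
      \<le> M + C0 + M') sequentially" if p: "p \<in> stab \<xi>" for p
  proof -
    note ps = stabilizer_boundary[OF p]
    have "act (inv p) \<circ> u \<in> \<xi>"
      using stabilizer_boundary(2)[OF ps(3)] u by (metis boundary_act_def imageI)
    then have 1: "eventually (\<lambda>i. gromov_product y (act (inv p) (u i)) (v i) \<le> M) sequentially"
      using M[OF _ v] by fastforce
    show ?thesis
      using 1 C[OF p] C[OF ps(3)] M[OF u v]
    proof eventually_elim
      case (elim i)
      have M0: "0 \<le> M" using elim(4) gromov_product_nonneg order_trans by blast
      \<comment> \<open>Translating by \<open>inv p\<close> replaces \<open>u\<close> by another
        representative of \<open>\<xi>\<close>, for which the uniform bound \<open>M\<close>
        holds.\<close>
      have "gromov_product (act p y) (u i) (act p (v i)) \<le> M"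
        using elim(1) gromov_product_act[OF ps(1), of y "act (inv p) (u i)" "v i"] ps(1) by simp
      \<comment> \<open>Since the product of \<open>u i\<close> and \<open>v i\<close> is at most
        \<open>M\<close>, one of the products of \<open>act (inv p) y\<close> with these two is at
        most \<open>M + k\<close>. If it is the one with \<open>u i\<close>, the Busemann bound
        makes the displacement itself at most \<open>M'\<close>.\<close>
      moreover have "gromov_product y (act (inv p) y) (v i) \<le> M'"
      proof (cases "gromov_product y (u i) (act (inv p) y) \<le> M + k")
        case True
        then have "dist y (act (inv p) y) \<le> M'"
          using double_gromov_product[of y "u i" "act (inv p) y"] elim(3)
          by (simp add: M'_def dist_commute)
        then show ?thesis using gromov_product_le_dist order_trans by blast
      next
        case False
        then have "gromov_product y (act (inv p) y) (v i) \<le> M + k"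
          using four_point[of y "u i" "act (inv p) y" "v i"] elim(4) by (simp add: k_def)
        then show ?thesis using M0 k0 elim(3) by (simp add: M'_def)
      qed
      moreover have "gromov_product y (act (inv p) y) (v i) = gromov_product (act p y) y (act p (v i))"
        using gromov_product_act[OF ps(1), of y "act (inv p) y" "v i"] ps(1) by simp
      ultimately show ?case
        using elim(2) M0 k0 double_gromov_product[of y "u i" "act p (v i)"]
          double_gromov_product[of "act p y" "u i" "act p (v i)"]
          double_gromov_product[of "act p y" y "act p (v i)"]
          gromov_product_nonneg[of "act p y" "u i" "act p (v i)"]
          gromov_product_nonneg[of "act p y" y "act p (v i)"]
        by (simp add: dist_commute abs_le_iff M'_def)
    qed
  qed
  then show ?thesis using u v by blast
qed

text \<open>The Gromov product is half the displacement up to a bounded error, so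
  \<open>\<kappa>\<close> is \<open>ln a / 2\<close> for the parameter \<open>a\<close> of the
  visual metric. The error \<open>C\<close> is uniform in \<open>p\<close>.\<close>

lemma stabilizer_visual_metric:
  assumes \<xi>: "\<xi> \<in> parabolic_points G act" and y: "y \<in> B \<xi>"
    and \<zeta>: "\<zeta> \<in> gromov_boundary" "\<zeta> \<noteq> \<xi>" and \<rho>: "visual_metric \<rho>"
  shows "\<exists>\<kappa>>0. \<exists>C. \<forall>p\<in>stab \<xi>. 0 < \<rho> \<xi> (boundary_act act p \<zeta>) \<and>
    \<bar>ln (\<rho> \<xi> (boundary_act act p \<zeta>)) + \<kappa> * dist y (act p y)\<bar> \<le> C"
proof -
  have b: "\<xi> \<in> gromov_boundary" using \<xi> parabolic_points_subset_boundary by blast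
  obtain u v C where uv: "u \<in> \<xi>" "v \<in> \<zeta>" and C: "\<And>p. p \<in> stab \<xi> \<Longrightarrow> eventually (\<lambda>i.
    \<bar>gromov_product y (u i) (act p (v i)) - dist y (act p y) / 2\<bar> \<le> C) sequentially"
    using stabilizer_gromov_product[OF \<xi> y \<zeta>] by blast
  obtain w a c1 c2 where a: "a > 1" and c: "c1 > 0" "c2 > 0"
    and vm: "\<And>\<xi> \<xi>'. \<xi> \<in> gromov_boundary \<Longrightarrow> \<xi>' \<in> gromov_boundary \<Longrightarrow>
           c1 * neg_power a (boundary_product w \<xi> \<xi>') \<le> \<rho> \<xi> \<xi>' \<and>
           \<rho> \<xi> \<xi>' \<le> c2 * neg_power a (boundary_product w \<xi> \<xi>')"
    using \<rho> unfolding visual_metric_def by blast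
  \<comment> \<open>The summands pay for the product estimate, the change of base point from
    \<open>y\<close> to \<open>w\<close>, and the change of representatives in
    \<open>boundary_product_ge\<close>.\<close>
  define E where "E = C + dist y w + 6 * \<delta>"
  define F where "F = \<bar>ln c1\<bar> + \<bar>ln c2\<bar> + E * ln a"
  have "0 < \<rho> \<xi> (boundary_act act p \<zeta>) \<and>
    \<bar>ln (\<rho> \<xi> (boundary_act act p \<zeta>)) + ln a / 2 * dist y (act p y)\<bar> \<le> F" if p: "p \<in> stab \<xi>" for p
  proof -
    note ps = stabilizer_boundary[OF p]
    define d where "d = dist y (act p y) / 2"
    have pb: "boundary_act act p \<zeta> \<in> gromov_boundary" using boundary_act_in_boundary ps \<zeta> by blast
    have pv: "act p \<circ> v \<in> boundary_act act p \<zeta>" using uv by (simp add: boundary_act_def)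
    have ev: "eventually (\<lambda>i. gromov_product w (u i) ((act p \<circ> v) i) \<le> d + (C + dist y w)) sequentially"
      "eventually (\<lambda>i. d - (C + dist y w) \<le> gromov_product w (u i) ((act p \<circ> v) i)) sequentially"
      using C[OF p]
    proof (eventually_elim)
      case (elim i)
      then show "gromov_product w (u i) ((act p \<circ> v) i) \<le> d + (C + dist y w)"
        using gromov_product_base[of w "u i" "act p (v i)" y]
        by (simp add: d_def dist_commute abs_le_iff)
    next
      show "eventually (\<lambda>i. d - (C + dist y w) \<le> gromov_product w (u i) ((act p \<circ> v) i)) sequentially"
        using C[OF p]
      proof eventually_elim
        case (elim i)
        then show ?case
          using gromov_product_base[of y "u i" "act p (v i)" w]
          by (simp add: d_def dist_commute abs_le_iff)
      qed
    qed
    have up: "boundary_product w \<xi> (boundary_act act p \<zeta>) \<le> ereal (d + (C + dist y w))"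
      by (rule boundary_product_le[OF uv(1) pv ev(1)])
    have lo: "ereal (d - (C + dist y w) - 2 * (3 * \<delta>)) \<le> boundary_product w \<xi> (boundary_act act p \<zeta>)"
      by (rule boundary_product_ge[OF b pb uv(1) pv ev(2)])
    \<comment> \<open>The two bounds exclude infinite values, so \<open>neg_power\<close> is a
      genuine power here.\<close>
    obtain r where r: "boundary_product w \<xi> (boundary_act act p \<zeta>) = ereal r" "\<bar>r - d\<bar> \<le> E"
      using up lo delta_nonneg
      by (cases "boundary_product w \<xi> (boundary_act act p \<zeta>)") (auto simp: E_def abs_le_iff)
    define R where "R = \<rho> \<xi> (boundary_act act p \<zeta>)"
    have R: "c1 * a powr (- r) \<le> R" "R \<le> c2 * a powr (- r)"
      using vm[OF b pb] r(1) by (simp_all add: neg_power_def R_def)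
    have "0 < c1 * a powr (- r)" using a c by simp
    then have "0 < R" using R by linarith
    have "ln c1 - r * ln a \<le> ln R" "ln R \<le> ln c2 - r * ln a"
      using ln_mono[OF R(1)] ln_mono[OF R(2)] \<open>0 < R\<close> a c by (simp_all add: ln_mult ln_powr)
    moreover have "\<bar>r * ln a - d * ln a\<bar> \<le> E * ln a"
      using mult_right_mono[OF r(2), of "ln a"] a by (simp add: abs_mult flip: left_diff_distrib)
    moreover have "ln a / 2 * dist y (act p y) = d * ln a" by (simp add: d_def)
    ultimately show ?thesis using \<open>0 < R\<close> unfolding F_def R_def[symmetric] by linarith
  qed
  moreover have "0 < ln a / 2" using a by simp
  ultimately show ?thesis by blast
qed

end

section \<open>Bilipschitz homeomorphisms of the half-line\<close>

text \<open>A continuous injection of an interval is strictly monotone; a decreasing one would miss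
  the value \<open>g 0 + 1\<close>.\<close>

lemma homeomorphism_halfline_strict_mono:
  fixes g g' :: "real \<Rightarrow> real"
  assumes "homeomorphism {0..} {0..} g g'"
  shows "strict_mono_on {0..} g"
proof -
  have g: "continuous_on {0..} g" "g ` {0..} = {0..}" "\<And>x. x \<ge> 0 \<Longrightarrow> g' (g x) = x"
    using assms by (auto simp: homeomorphism_def)
  have "inj_on g {0..}" by (rule inj_on_inverseI[of _ g']) (use g in auto)
  moreover have "is_interval {0::real..}" by (simp add: is_interval_ci)
  ultimately consider "strict_mono_on {0..} g" | "strict_antimono_on {0..} g"
    using injective_eq_monotone_map[of "{0..}" g] g(1) by blast
  then show ?thesis
  proof cases
    case 2
    have "g 0 \<in> {0..}" using g(2) by blast
    then have "g 0 + 1 \<in> {0..}" by simp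
    then obtain t where t: "t \<ge> 0" "g t = g 0 + 1" using g(2) by (metis atLeast_iff imageE)
    then have "t > 0" by (cases "t = 0") auto
    then have "g t < g 0" using 2 by (auto simp: monotone_on_def)
    then show ?thesis using t by simp
  qed
qed

text \<open>For the control function of a quasisymmetry this is the contracting half of the
  definition. The preimages of \<open>e\<close> and \<open>e / 2\<close> are distinct and
  non-negative, so one of them is positive.\<close>

lemma homeomorphism_halfline_small:
  fixes g g' :: "real \<Rightarrow> real"
  assumes "homeomorphism {0..} {0..} g g'" "0 < e"
  shows "\<exists>t>0. g t \<le> e"
proof -
  have g: "\<And>x. x \<ge> 0 \<Longrightarrow> g' x \<ge> 0" "\<And>x. x \<ge> 0 \<Longrightarrow> g (g' x) = x"
    using assms by (auto simp: homeomorphism_def)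
  have "g' e \<noteq> g' (e / 2)" using g(2)[of e] g(2)[of "e / 2"] assms(2) by auto
  then consider "g' e > 0" | "g' (e / 2) > 0"
    using g(1)[of e] g(1)[of "e / 2"] assms(2) by linarith
  then show ?thesis
  proof cases
    case 1
    then show ?thesis using g(2)[of e] assms(2) by (intro exI[of _ "g' e"]) auto
  next
    case 2
    then show ?thesis using g(2)[of "e / 2"] assms(2) by (intro exI[of _ "g' (e / 2)"]) auto
  qed
qed

lemma bilipschitz_homeomorphism_bounds:
  assumes "bilipschitz_homeomorphism g"
  obtains L where "L > 0"
    "\<And>s t. 0 \<le> s \<Longrightarrow> s \<le> t \<Longrightarrow> t - s \<le> L * (g t - g s) \<and> g t - g s \<le> L * (t - s)"
proof -
  obtain g' L where h: "homeomorphism {0..} {0..} g g'"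
    and L: "L-lipschitz_on {0..} g" "L-lipschitz_on {0..} g'"
    using assms unfolding bilipschitz_homeomorphism_def by blast
  have g: "\<And>x. x \<ge> 0 \<Longrightarrow> g x \<ge> 0" "\<And>x. x \<ge> 0 \<Longrightarrow> g' (g x) = x"
    using h by (auto simp: homeomorphism_def)
  have "t - s \<le> L * (g t - g s) \<and> g t - g s \<le> L * (t - s)" if "0 \<le> s" "s \<le> t" for s t
  proof -
    have "g s \<le> g t"
      using homeomorphism_halfline_strict_mono[OF h] that by (cases "s = t") (auto simp: monotone_on_def less_le)
    then show ?thesis
      using lipschitz_onD[OF L(1), of s t] lipschitz_onD[OF L(2), of "g s" "g t"] g that
      by (simp add: dist_real_def abs_real_def split: if_splits)
  qed
  moreover have "L > 0"
    using calculation[of 0 1] lipschitz_on_nonneg[OF L(1)] by (cases "L = 0") auto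
  ultimately show ?thesis using that by blast
qed

text \<open>The lower slope \<open>m\<close> gives injectivity, unboundedness and hence, by
  intermediate values, surjectivity, as well as the Lipschitz constant \<open>1 / m\<close> of the
  inverse.\<close>

lemma bilipschitz_homeomorphismI:
  assumes "g 0 = 0" "m > 0"
    and bd: "\<And>s t. 0 \<le> s \<Longrightarrow> s \<le> t \<Longrightarrow> m * (t - s) \<le> g t - g s \<and> g t - g s \<le> M * (t - s)"
  shows "bilipschitz_homeomorphism g"
proof -
  have M: "m \<le> M" using bd[of 0 1] by simp
  have lip: "M-lipschitz_on {0..} g"
  proof (rule lipschitz_onI)
    fix s t :: real assume st: "s \<in> {0..}" "t \<in> {0..}"
    have "\<bar>g t - g s\<bar> \<le> M * \<bar>t - s\<bar>" if "0 \<le> s" "s \<le> t" for s t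
    proof -
      have "0 \<le> m * (t - s)" using that assms(2) by simp
      then have "0 \<le> g t - g s" using bd[OF that] by linarith
      then show ?thesis using bd[OF that] that by simp
    qed
    from this[of s t] this[of t s] show "dist (g s) (g t) \<le> M * dist s t"
      using st by (cases "s \<le> t") (auto simp: dist_real_def abs_minus_commute)
  qed (use M assms(2) in auto)
  have low: "m * \<bar>t - s\<bar> \<le> \<bar>g t - g s\<bar>" if "0 \<le> s" "0 \<le> t" for s t
    using bd[of s t] bd[of t s] that by (cases "s \<le> t") (auto simp: abs_real_def)
  have inj: "inj_on g {0..}"
  proof (rule inj_onI)
    fix s t assume "s \<in> {0..}" "t \<in> {0..}" "g s = g t"
    then show "s = t" using low[of s t] assms(2) by (simp add: mult_le_0_iff)
  qed
  have img: "g ` {0..} = {0..}"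
  proof (intro equalityI subsetI)
    fix y assume "y \<in> g ` {0..}"
    then obtain t where t: "t \<ge> 0" "y = g t" by auto
    then have "m * t \<le> y" using bd[of 0 t] assms(1) by simp
    moreover have "0 \<le> m * t" using t(1) assms(2) by simp
    ultimately show "y \<in> {0..}" by simp
  next
    fix y :: real assume "y \<in> {0..}"
    then have y: "g 0 \<le> y" "y \<le> g (y / m)" using bd[of 0 "y / m"] assms(1,2) by auto
    have "continuous_on {0..y / m} g"
      using continuous_on_subset[OF lipschitz_on_continuous_on[OF lip]] by auto
    then obtain t where "0 \<le> t" "g t = y"
      using IVT'[of g 0 y "y / m"] y \<open>y \<in> {0..}\<close> assms(2) by auto
    then show "y \<in> g ` {0..}" by auto
  qed
  define g' where "g' = inv_into {0..} g"
  have g': "g' y \<ge> 0" "g (g' y) = y" if "y \<ge> 0" for y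
    using inv_into_into[of y g "{0..}"] f_inv_into_f[of y g "{0..}"] img that by (auto simp: g'_def)
  have g'g: "g' (g t) = t" if "t \<ge> 0" for t
    using inv_into_f_f[OF inj] that by (simp add: g'_def)
  have lip': "(1 / m)-lipschitz_on {0..} g'"
  proof (rule lipschitz_onI)
    fix x y :: real assume "x \<in> {0..}" "y \<in> {0..}"
    then show "dist (g' x) (g' y) \<le> 1 / m * dist x y"
      using low[of "g' x" "g' y"] g'[of x] g'[of y] assms(2)
      by (simp add: dist_real_def field_simps abs_minus_commute)
  qed (use assms(2) in auto)
  have "homeomorphism {0..} {0..} g g'"
  proof (rule homeomorphismI)
    show "continuous_on {0..} g" "continuous_on {0..} g'"
      using lip lip' lipschitz_on_continuous_on by blast+
  qed (use img g' g'g in auto)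
  moreover have "(max M (1 / m))-lipschitz_on {0..} g" "(max M (1 / m))-lipschitz_on {0..} g'"
    using lipschitz_on_le[OF lip] lipschitz_on_le[OF lip'] by auto
  ultimately show ?thesis unfolding bilipschitz_homeomorphism_def by blast
qed

lemma bilipschitz_homeomorphism_inverse:
  assumes "bilipschitz_homeomorphism g"
  obtains g' where "bilipschitz_homeomorphism g'" "\<And>x. x \<ge> 0 \<Longrightarrow> g' (g x) = x"
proof -
  obtain g' L where h: "homeomorphism {0..} {0..} g g'"
    and L: "L-lipschitz_on {0..} g" "L-lipschitz_on {0..} g'"
    using assms unfolding bilipschitz_homeomorphism_def by blast
  have "bilipschitz_homeomorphism g'"
    unfolding bilipschitz_homeomorphism_def using homeomorphism_sym[THEN iffD1, OF h] L by blast
  then show ?thesis using that h by (auto simp: homeomorphism_def)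
qed

lemma bilipschitz_homeomorphism_zero:
  assumes "bilipschitz_homeomorphism g"
  shows "g 0 = 0"
proof -
  obtain g' where h: "homeomorphism {0..} {0..} g g'"
    using assms unfolding bilipschitz_homeomorphism_def by blast
  then have g: "g 0 \<ge> 0" "g' 0 \<ge> 0" "g (g' 0) = 0" by (auto simp: homeomorphism_def)
  show ?thesis
  proof (cases "g' 0 = 0")
    case False
    then have "g 0 < g (g' 0)"
      using homeomorphism_halfline_strict_mono[OF h] g(2) by (simp add: monotone_on_def)
    then show ?thesis using g by simp
  qed (use g in auto)
qed

lemma bilipschitz_homeomorphism_scale:
  assumes g: "bilipschitz_homeomorphism g" and c: "c > 0"
  shows "bilipschitz_homeomorphism (\<lambda>t. c * g t)"
proof -
  obtain L where L: "L > 0"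
    "\<And>s t. 0 \<le> s \<Longrightarrow> s \<le> t \<Longrightarrow> t - s \<le> L * (g t - g s) \<and> g t - g s \<le> L * (t - s)"
    using bilipschitz_homeomorphism_bounds[OF g] by blast
  show ?thesis
  proof (rule bilipschitz_homeomorphismI[of _ "c / L" "c * L"])
    fix s t :: real assume "0 \<le> s" "s \<le> t"
    from L(2)[OF this]
    have "c * (t - s) \<le> c * (L * (g t - g s))" "c * (g t - g s) \<le> c * (L * (t - s))"
      using c by simp_all
    then show "c / L * (t - s) \<le> c * g t - c * g s \<and> c * g t - c * g s \<le> c * L * (t - s)"
      using L(1) by (simp add: field_simps)
  qed (use L(1) c bilipschitz_homeomorphism_zero[OF g] in auto)
qed

text \<open>The interpolation is affine between consecutive integers, with the gaps of
  \<open>x\<close> as slopes.\<close>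

lemma bilipschitz_interpolation:
  fixes x :: "nat \<Rightarrow> real"
  assumes x0: "x 0 = 0" and gap: "\<And>k. x k + 1 \<le> x (Suc k)" "\<And>k. x (Suc k) \<le> x k + T"
  obtains g where "bilipschitz_homeomorphism g" "\<And>k. g (real k) = x k"
proof -
  define g where "g t = x (nat \<lfloor>t\<rfloor>) + (t - real (nat \<lfloor>t\<rfloor>)) * (x (Suc (nat \<lfloor>t\<rfloor>)) - x (nat \<lfloor>t\<rfloor>))" for t
  have steps: "real n \<le> x (j + n) - x j \<and> x (j + n) - x j \<le> T * real n" for j n
  proof (induction n)
    case (Suc n)
    then show ?case using gap[of "j + n"] by (simp add: algebra_simps)
  qed simp
  have "1 * (t - s) \<le> g t - g s \<and> g t - g s \<le> T * (t - s)" if st: "0 \<le> s" "s \<le> t" for s t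
  proof -
    define j where "j = nat \<lfloor>s\<rfloor>"
    define k where "k = nat \<lfloor>t\<rfloor>"
    define a where "a = x (Suc j) - x j"
    define b where "b = x (Suc k) - x k"
    have jk: "real j \<le> s" "s \<le> real j + 1" "real k \<le> t" "j \<le> k"
      using st by (auto simp: j_def k_def nat_mono floor_mono)
    have ab: "1 \<le> a" "a \<le> T" "1 \<le> b" "b \<le> T" using gap[of j] gap[of k] by (auto simp: a_def b_def)
    have eq: "g s = x j + (s - real j) * a" "g t = x k + (t - real k) * b"
      by (simp_all add: g_def j_def k_def a_def b_def)
    show ?thesis
    proof (cases "j = k")
      case True
      then have "g t - g s = (t - s) * a" using eq by (simp add: a_def b_def algebra_simps)
      then show ?thesis
        using mult_left_mono[of 1 a "t - s"] mult_left_mono[of a T "t - s"] ab st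
        by (simp add: mult.commute)
    next
      case False
      then obtain n where n: "k = Suc j + n" using jk(4) by (metis le_neq_implies_less less_iff_Suc_add add_Suc)
      \<comment> \<open>The interval from \<open>s\<close> to \<open>t\<close> is cut at the
        integers \<open>j + 1\<close> and \<open>k\<close>; each of the three pieces has slopes
        between 1 and \<open>T\<close>.\<close>
      have gs: "g t - g s = (x (Suc j + n) - x (Suc j)) + (real j + 1 - s) * a + (t - real k) * b"
        unfolding eq n a_def by (simp add: algebra_simps)
      have ts: "t - s = real n + (real j + 1 - s) + (t - real k)" by (simp add: n)
      have Tts: "T * (t - s) = T * real n + T * (real j + 1 - s) + T * (t - real k)"
        unfolding ts by (simp only: distrib_left)
      have le: "real j + 1 - s \<le> (real j + 1 - s) * a" "(real j + 1 - s) * a \<le> T * (real j + 1 - s)"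
        "t - real k \<le> (t - real k) * b" "(t - real k) * b \<le> T * (t - real k)"
        using mult_left_mono[of 1 a "real j + 1 - s"] mult_left_mono[of a T "real j + 1 - s"]
          mult_left_mono[of 1 b "t - real k"] mult_left_mono[of b T "t - real k"] ab jk
        by (simp_all add: mult.commute)
      have "t - s \<le> g t - g s" unfolding gs ts by (intro add_mono le steps[THEN conjunct1])
      moreover have "g t - g s \<le> T * (t - s)"
        unfolding gs Tts by (intro add_mono le steps[THEN conjunct2])
      ultimately show ?thesis by simp
    qed
  qed
  then have "bilipschitz_homeomorphism g"
    by (intro bilipschitz_homeomorphismI[of g 1 T]) (auto simp: g_def x0)
  moreover have "g (real k) = x k" for k by (simp add: g_def)
  ultimately show ?thesis using that by blast
qed

section \<open>Transfer of exponential distortion\<close>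

text \<open>The new bilipschitz function interpolates between elements of length \<open>N\<^sup>k\<close>, for fixed large
  \<open>N\<close>: their \<open>d2\<close>-values have successive gaps bounded above and bounded below by \<open>1\<close>.\<close>

lemma exponential_distortion_transfer:
  fixes d1 d2 :: "'a \<Rightarrow> real" and len :: "'a \<Rightarrow> nat"
  assumes g1: "bilipschitz_homeomorphism g1"
    and d: "\<And>p. p \<in> Q \<Longrightarrow> 0 \<le> d1 p" "\<And>p. p \<in> Q \<Longrightarrow> 0 \<le> d2 p"
    and dist1: "\<And>p. p \<in> Q \<Longrightarrow> 1 / b * exp (g1 (d1 p)) \<le> real (len p)"
      "\<And>p. p \<in> Q \<Longrightarrow> real (len p) \<le> b * exp (g1 (d1 p))" "b > 0"
    and len: "\<And>p. p \<in> Q \<Longrightarrow> 1 \<le> len p" "\<And>n. 1 \<le> n \<Longrightarrow> \<exists>p\<in>Q. len p = n"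
    and coarse: "\<And>s. \<exists>S. \<forall>p\<in>Q. \<forall>q\<in>Q. d1 q \<le> d1 p + s \<longrightarrow> d2 q \<le> d2 p + S"
      "\<exists>R. \<forall>p\<in>Q. \<forall>q\<in>Q. d1 q + R \<le> d1 p \<longrightarrow> d2 q + 1 \<le> d2 p"
  shows "\<exists>g2 b'. bilipschitz_homeomorphism g2 \<and> b' > 0 \<and>
    (\<forall>p\<in>Q. 1 / b' * exp (g2 (d2 p)) \<le> real (len p) \<and> real (len p) \<le> b' * exp (g2 (d2 p)))"
proof -
  define l where "l p = ln (real (len p))" for p
  define \<beta> where "\<beta> = ln b"
  have l: "\<bar>l p - g1 (d1 p)\<bar> \<le> \<beta>" "0 \<le> l p" if p: "p \<in> Q" for p
  proof -
    have "ln (exp (g1 (d1 p)) / b) \<le> l p" "l p \<le> ln (b * exp (g1 (d1 p)))"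
      using dist1(1,2)[OF p] dist1(3) len(1)[OF p] unfolding l_def by (auto intro!: ln_mono)
    then show "\<bar>l p - g1 (d1 p)\<bar> \<le> \<beta>" using dist1(3) by (simp add: ln_mult ln_div \<beta>_def)
    show "0 \<le> l p" using len(1)[OF p] by (simp add: l_def)
  qed
  obtain L where L: "L > 0"
    "\<And>s t. 0 \<le> s \<Longrightarrow> s \<le> t \<Longrightarrow> t - s \<le> L * (g1 t - g1 s) \<and> g1 t - g1 s \<le> L * (t - s)"
    using bilipschitz_homeomorphism_bounds[OF g1] by blast
  have \<beta>: "0 \<le> \<beta>" using l len(2)[of 1] by fastforce
  \<comment> \<open>The lower bilipschitz bound of \<open>g1\<close> turns an increase of
    \<open>s\<close> in logarithmic length into an increase of at most
    \<open>L * (s + 2 * \<beta>)\<close> in \<open>d1\<close>.\<close>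
  have A: "\<exists>S. \<forall>p\<in>Q. \<forall>q\<in>Q. l q \<le> l p + s \<longrightarrow> d2 q \<le> d2 p + S" if "s \<ge> 0" for s
  proof -
    have "d1 q \<le> d1 p + L * (s + 2 * \<beta>)" if pq: "p \<in> Q" "q \<in> Q" "l q \<le> l p + s" for p q
    proof (cases "d1 q \<le> d1 p")
      case True
      then show ?thesis using L(1) \<beta> \<open>s \<ge> 0\<close> by (simp add: add_increasing2)
    next
      case False
      then have "d1 q - d1 p \<le> L * (g1 (d1 q) - g1 (d1 p))" using L(2) d(1) pq by simp
      also have "\<dots> \<le> L * (s + 2 * \<beta>)"
        using L(1) l(1)[OF pq(1)] l(1)[OF pq(2)] pq(3) by (intro mult_left_mono) linarith+
      finally show ?thesis by simp
    qed
    then show ?thesis using coarse(1)[of "L * (s + 2 * \<beta>)"] by blast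
  qed
  obtain R where R: "\<forall>p\<in>Q. \<forall>q\<in>Q. d1 q + R \<le> d1 p \<longrightarrow> d2 q + 1 \<le> d2 p" using coarse(2) by blast
  \<comment> \<open>The term \<open>2 * \<beta>\<close> absorbs the errors of two logarithmic
    lengths, and \<open>L * \<bar>R\<bar>\<close> forces \<open>d1\<close> to grow by
    \<open>R\<close>. The 1 makes the growth strict, which settles the order of the
    \<open>d1\<close> values.\<close>
  obtain N :: nat where "exp (2 * \<beta> + L * \<bar>R\<bar> + 1) \<le> real N" using real_arch_simple by blast
  moreover from this have "real N > 0" using exp_gt_zero less_le_trans by blast
  ultimately have N: "2 * \<beta> + L * \<bar>R\<bar> + 1 \<le> ln (real N)" "real N > 0"
    by (simp_all add: ln_ge_iff)
  have "0 \<le> L * \<bar>R\<bar>" using L(1) by simp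
  then have lnN: "0 < ln (real N)" using N(1) \<beta> by linarith
  have B: "d2 q + 1 \<le> d2 p" if pq: "p \<in> Q" "q \<in> Q" "l q + ln (real N) \<le> l p" for p q
  proof -
    have gap: "g1 (d1 q) + L * \<bar>R\<bar> + 1 \<le> g1 (d1 p)"
      using l(1)[OF pq(1)] l(1)[OF pq(2)] pq(3) N(1) by linarith
    have "d1 q \<le> d1 p"
    proof (rule ccontr)
      assume "\<not> d1 q \<le> d1 p"
      then have "0 \<le> L * (g1 (d1 q) - g1 (d1 p))" using L(2)[of "d1 p" "d1 q"] d(1) pq by force
      then show False using gap L(1) \<open>0 \<le> L * \<bar>R\<bar>\<close> by (simp add: zero_le_mult_iff)
    qed
    then have "L * \<bar>R\<bar> \<le> L * (d1 p - d1 q)" using L(2)[of "d1 q" "d1 p"] d(1) pq gap by simp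
    then have "d1 q + R \<le> d1 p" using L(1) by simp
    then show ?thesis using R pq by blast
  qed
  have "\<exists>p. p \<in> Q \<and> len p = N ^ k" for k using len(2)[of "N ^ k"] N(2) by auto
  then have "\<exists>r. \<forall>k. r k \<in> Q \<and> len (r k) = N ^ k" by (intro choice allI)
  then obtain r where r: "\<And>k. r k \<in> Q" "\<And>k. len (r k) = N ^ k" by blast
  have lr: "l (r k) = real k * ln (real N)" for k
    unfolding l_def r(2) of_nat_power by (rule ln_realpow)
  \<comment> \<open>The shift by \<open>d2 (r 0)\<close> makes the samples start at 0, which every
    bilipschitz homeomorphism of the half-line fixes.\<close>
  define x where "x k = d2 (r k) - d2 (r 0)" for k
  obtain T where T: "\<forall>p\<in>Q. \<forall>q\<in>Q. l q \<le> l p + ln (real N) \<longrightarrow> d2 q \<le> d2 p + T"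
    using A[of "ln (real N)"] lnN by auto
  have x: "x k + 1 \<le> x (Suc k)" "x (Suc k) \<le> x k + T" for k
    using B[OF r(1)[of "Suc k"] r(1)[of k]] T[rule_format, OF r(1)[of k] r(1)[of "Suc k"]]
    by (simp_all add: x_def lr algebra_simps)
  obtain g where g: "bilipschitz_homeomorphism g" "\<And>k. g (real k) = x k"
    using bilipschitz_interpolation[of x T] x by (auto simp: x_def)
  obtain g' where g': "bilipschitz_homeomorphism g'" "\<And>t. t \<ge> 0 \<Longrightarrow> g' (g t) = t"
    using bilipschitz_homeomorphism_inverse[OF g(1)] by blast
  \<comment> \<open>This sends the sample \<open>x k\<close> to \<open>l (r k)\<close>, the
    logarithm of \<open>N ^ k\<close>.\<close>
  define g2 where "g2 t = ln (real N) * g' t" for t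
  have bg2: "bilipschitz_homeomorphism g2"
    unfolding g2_def[abs_def] by (rule bilipschitz_homeomorphism_scale[OF g'(1) lnN])
  have g2x: "g2 (x k) = real k * ln (real N)" for k
    using g'(2)[of "real k"] g(2)[of k] by (simp add: g2_def)
  have x0: "0 \<le> x k" for k
  proof (induction k)
    case (Suc k)
    then show ?case using x(1)[of k] by linarith
  qed (simp add: x_def)
  obtain L2 where L2: "L2 > 0"
    "\<And>s t. 0 \<le> s \<Longrightarrow> s \<le> t \<Longrightarrow> t - s \<le> L2 * (g2 t - g2 s) \<and> g2 t - g2 s \<le> L2 * (t - s)"
    using bilipschitz_homeomorphism_bounds[OF bg2] by blast
  have up: "g2 t \<le> g2 s + L2 * c" if "0 \<le> s" "0 \<le> t" "t \<le> s + c" "0 \<le> c" for s t c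
  proof (cases "s \<le> t")
    case True
    then have "g2 t - g2 s \<le> L2 * (t - s)" using L2(2) that by blast
    also have "\<dots> \<le> L2 * c" using L2(1) that by simp
    finally show ?thesis by simp
  next
    case False
    then have "0 \<le> L2 * (g2 s - g2 t)" using L2(2)[of t s] that by simp
    then have "g2 t \<le> g2 s" using L2(1) by (simp add: zero_le_mult_iff)
    moreover have "0 \<le> L2 * c" using L2(1) that by simp
    ultimately show ?thesis by simp
  qed
  obtain S where S: "\<forall>p\<in>Q. \<forall>q\<in>Q. l q \<le> l p + 0 \<longrightarrow> d2 q \<le> d2 p + S" using A[of 0] by auto
  \<comment> \<open>\<open>S\<close> compares \<open>d2\<close> at elements of ordered lengths; the
    other summand restores the shift hidden in \<open>x\<close>.\<close>
  define c where "c = \<bar>S\<bar> + d2 (r 0)"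
  have c0: "0 \<le> c" using d(2)[OF r(1)] by (simp add: c_def)
  define E where "E = ln (real N) + L2 * c"
  have E: "\<bar>l p - g2 (d2 p)\<bar> \<le> E" if p: "p \<in> Q" for p
  proof -
    \<comment> \<open>The length of \<open>p\<close> lies between the consecutive powers
      \<open>N ^ k\<close> and \<open>N ^ (k + 1)\<close>, so \<open>p\<close> is squeezed between
      two samples.\<close>
    define k where "k = nat \<lfloor>l p / ln (real N)\<rfloor>"
    have "real k \<le> l p / ln (real N)" "l p / ln (real N) \<le> real (Suc k)"
      using l(2)[OF p] lnN unfolding k_def by (simp_all, linarith+)
    then have k: "l (r k) \<le> l p" "l p \<le> l (r (Suc k))" using lnN by (simp_all only: lr field_simps)
    have "d2 p \<le> d2 (r (Suc k)) + S" "d2 (r k) \<le> d2 p + S" using S k p r(1) by auto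
    then have "d2 p \<le> x (Suc k) + c" "x k \<le> d2 p + c"
      using d(2)[OF r(1)[of 0]] unfolding x_def c_def by linarith+
    then have "g2 (d2 p) \<le> g2 (x (Suc k)) + L2 * c" "g2 (x k) \<le> g2 (d2 p) + L2 * c"
      using up x0 d(2)[OF p] c0 by auto
    moreover have "g2 (x k) = l (r k)" "g2 (x (Suc k)) = l (r k) + ln (real N)"
      by (simp_all add: g2x lr algebra_simps)
    moreover have "l (r (Suc k)) = l (r k) + ln (real N)" by (simp add: lr algebra_simps)
    ultimately show ?thesis using k unfolding E_def by linarith
  qed
  have "1 / exp E * exp (g2 (d2 p)) \<le> real (len p) \<and> real (len p) \<le> exp E * exp (g2 (d2 p))"
    if p: "p \<in> Q" for p
  proof -
    have "real (len p) = exp (l p)" using len(1)[OF p] by (simp add: l_def)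
    moreover have "exp (g2 (d2 p) - E) \<le> exp (l p)" "exp (l p) \<le> exp (E + g2 (d2 p))"
      using E[OF p] by (simp_all add: abs_le_iff)
    ultimately show ?thesis by (simp add: exp_diff exp_add)
  qed
  then show ?thesis using bg2 exp_gt_zero[of E] by blast
qed

text \<open>In the application \<open>r1 p\<close> and \<open>r2 p\<close> are visual distances from the parabolic point to \<open>p \<zeta>\<close>, and
  \<open>d1 p\<close> and \<open>d2 p\<close> are displacements of base points.\<close>

lemma quasisymmetric_comparison:
  fixes r1 r2 d1 d2 :: "'a \<Rightarrow> real"
  assumes \<eta>: "homeomorphism {0..} {0::real..} \<eta> \<eta>'"
    and qs: "\<And>t p q. 0 \<le> t \<Longrightarrow> p \<in> P \<Longrightarrow> q \<in> P \<Longrightarrow> r1 p \<le> t * r1 q \<Longrightarrow> r2 p \<le> \<eta> t * r2 q"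
    and r: "\<And>p. p \<in> P \<Longrightarrow> 0 < r1 p" "\<And>p. p \<in> P \<Longrightarrow> 0 < r2 p"
    and d1: "\<And>p. p \<in> P \<Longrightarrow> \<bar>ln (r1 p) + \<kappa>1 * d1 p\<bar> \<le> C1" "\<kappa>1 > 0"
    and d2: "\<And>p. p \<in> P \<Longrightarrow> \<bar>ln (r2 p) + \<kappa>2 * d2 p\<bar> \<le> C2" "\<kappa>2 > 0"
  shows "\<exists>S. \<forall>p\<in>P. \<forall>q\<in>P. d1 q \<le> d1 p + s \<longrightarrow> d2 q \<le> d2 p + S"
    and "\<exists>R. \<forall>p\<in>P. \<forall>q\<in>P. d1 q + R \<le> d1 p \<longrightarrow> d2 q + 1 \<le> d2 p"
proof -
  \<comment> \<open>Visual distance decreases with displacement, which reverses the roles of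
    \<open>p\<close> and \<open>q\<close>. Both claims are instances: a fixed \<open>t\<close>
    adapted to \<open>s\<close> bounds the growth, a small \<open>t\<close> forces an
    increase.\<close>
  have main: "0 < \<eta> t \<and> \<kappa>2 * (d2 q - d2 p) \<le> ln (\<eta> t) + 2 * C2"
    if t: "t > 0" and pq: "p \<in> P" "q \<in> P" and le: "\<kappa>1 * (d1 q - d1 p) \<le> ln t - 2 * C1" for t p q
  proof -
    have "ln (r1 p) \<le> ln (t * r1 q)"
      using d1(1)[OF pq(1)] d1(1)[OF pq(2)] le t r(1)[OF pq(2)]
      by (simp add: ln_mult abs_le_iff right_diff_distrib)
    then have "r1 p \<le> t * r1 q" using t r(1) pq by (simp add: ln_le_cancel_iff)
    then have r2: "r2 p \<le> \<eta> t * r2 q" using qs t pq by simp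
    then have pos: "0 < \<eta> t" using r(2)[OF pq(1)] r(2)[OF pq(2)] 
      by (smt (verit) mult_nonpos_nonneg)
    have "ln (r2 p) \<le> ln (\<eta> t * r2 q)" using r2 r(2)[OF pq(1)] by (rule ln_mono)
    also have "\<dots> = ln (\<eta> t) + ln (r2 q)" using pos r(2)[OF pq(2)] by (simp add: ln_mult)
    finally show ?thesis
      using d2(1)[OF pq(1)] d2(1)[OF pq(2)] pos by (simp add: abs_le_iff right_diff_distrib)
  qed
  show "\<exists>S. \<forall>p\<in>P. \<forall>q\<in>P. d1 q \<le> d1 p + s \<longrightarrow> d2 q \<le> d2 p + S"
  proof (intro exI ballI impI)
    fix p q assume pq: "p \<in> P" "q \<in> P" "d1 q \<le> d1 p + s"
    define t where "t = exp (2 * C1 + \<kappa>1 * s)"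
    have "\<kappa>1 * (d1 q - d1 p) \<le> \<kappa>1 * s" using pq(3) d1(2) by simp
    then have "\<kappa>2 * (d2 q - d2 p) \<le> ln (\<eta> t) + 2 * C2" using main[of t p q] pq by (simp add: t_def)
    then show "d2 q \<le> d2 p + (ln (\<eta> (exp (2 * C1 + \<kappa>1 * s))) + 2 * C2) / \<kappa>2"
      using d2(2) by (simp add: t_def field_simps)
  qed
  show "\<exists>R. \<forall>p\<in>P. \<forall>q\<in>P. d1 q + R \<le> d1 p \<longrightarrow> d2 q + 1 \<le> d2 p"
  proof -
    \<comment> \<open>The target value is chosen so that \<open>ln (\<eta> t) + 2 * C2\<close> is at
      most \<open>- \<kappa>2\<close>, that is, one unit of \<open>d2\<close>.\<close>
    obtain t where t: "t > 0" "\<eta> t \<le> exp (- \<kappa>2 - 2 * C2)"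
      using homeomorphism_halfline_small[OF \<eta>, of "exp (- \<kappa>2 - 2 * C2)"] by auto
    have "d2 q + 1 \<le> d2 p" if pq: "p \<in> P" "q \<in> P" "d1 q + (2 * C1 - ln t) / \<kappa>1 \<le> d1 p" for p q
    proof -
      have "\<kappa>1 * (d1 q - d1 p) \<le> ln t - 2 * C1" using pq(3) d1(2) by (simp add: field_simps)
      from main[OF t(1) pq(1,2) this] have "0 < \<eta> t" "\<kappa>2 * (d2 q - d2 p) \<le> ln (\<eta> t) + 2 * C2" by auto
      moreover have "ln (\<eta> t) \<le> - \<kappa>2 - 2 * C2" using ln_mono[OF t(2)] \<open>0 < \<eta> t\<close> by simp
      ultimately have "\<kappa>2 * (d2 q - d2 p) \<le> \<kappa>2 * (- 1)" by simp
      then have "d2 q - d2 p \<le> - 1" using d2(2) by (simp only: mult_le_cancel_left_pos)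
      then show ?thesis by simp
    qed
    then show ?thesis by blast
  qed
qed

section \<open>Word lengths\<close>

context group
begin

abbreviation word_product :: "'a list \<Rightarrow> 'a" where
  "word_product ws \<equiv> foldr (\<lambda>a b. a \<otimes> b) ws \<one>"

lemma word_product_append:
  assumes "set us \<subseteq> carrier G" "set vs \<subseteq> carrier G"
  shows "word_product (us @ vs) = word_product us \<otimes> word_product vs"
proof -
  have c: "word_product ws \<in> carrier G" if "set ws \<subseteq> carrier G" for ws
    using that by (induction ws) auto
  show ?thesis
    using assms(1)
  proof (induction us)
    case Nil
    then show ?case using c[OF assms(2)] by simp
  next
    case (Cons a us)
    then show ?case using c[of us] c[OF assms(2)] by (simp add: m_assoc)
  qed
qed

lemma generate_iff_word:
  assumes "S \<subseteq> carrier G"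
  shows "g \<in> generate G S \<longleftrightarrow> (\<exists>ws. set ws \<subseteq> S \<union> m_inv G ` S \<and> word_product ws = g)"
proof
  have SC: "S \<union> m_inv G ` S \<subseteq> carrier G" using assms by auto
  show "\<exists>ws. set ws \<subseteq> S \<union> m_inv G ` S \<and> word_product ws = g" if "g \<in> generate G S"
    using that
  proof induction
    case one
    then show ?case by (intro exI[of _ "[]"]) auto
  next
    case (incl h)
    then show ?case using assms by (intro exI[of _ "[h]"]) auto
  next
    case (inv h)
    then show ?case using assms by (intro exI[of _ "[inv h]"]) auto
  next
    case (eng h1 h2)
    then obtain us vs where "set us \<subseteq> S \<union> m_inv G ` S" "word_product us = h1"
      "set vs \<subseteq> S \<union> m_inv G ` S" "word_product vs = h2" by blast
    then show ?case
      using word_product_append[of us vs] SC by (intro exI[of _ "us @ vs"]) auto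
  qed
  assume "\<exists>ws. set ws \<subseteq> S \<union> m_inv G ` S \<and> word_product ws = g"
  then obtain ws where "set ws \<subseteq> S \<union> m_inv G ` S" "word_product ws = g" by blast
  then show "g \<in> generate G S"
  proof (induction ws arbitrary: g)
    case Nil
    then show ?case by (auto intro: generate.one)
  next
    case (Cons a ws)
    then show ?case by (auto intro!: generate.eng intro: generate.incl generate.inv)
  qed
qed

lemma word_length_le:
  assumes "set ws \<subseteq> S \<union> m_inv G ` S"
  shows "word_length G S (word_product ws) \<le> length ws"
  unfolding word_length_def by (rule Least_le) (use assms in blast)

text \<open>Outside the generated subgroup the \<open>LEAST\<close> in \<open>word_length\<close>
  ranges over an empty set; membership makes the minimum the length of an actual word.\<close>

lemma word_length_attained:
  assumes "S \<subseteq> carrier G" "g \<in> generate G S"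
  obtains ws where "set ws \<subseteq> S \<union> m_inv G ` S" "word_product ws = g" "length ws = word_length G S g"
proof -
  have "\<exists>n ws. length ws = n \<and> set ws \<subseteq> S \<union> m_inv G ` S \<and> word_product ws = g"
    using assms generate_iff_word by blast
  from LeastI_ex[OF this] show ?thesis using that unfolding word_length_def by blast
qed

lemma word_length_pos:
  assumes "S \<subseteq> carrier G" "g \<in> generate G S" "g \<noteq> \<one>"
  shows "1 \<le> word_length G S g"
proof -
  obtain ws where "word_product ws = g" "length ws = word_length G S g"
    using word_length_attained[OF assms(1,2)] .
  then show ?thesis using assms(3) by (cases ws) auto
qed

lemma word_length_one [simp]: "word_length G S \<one> = 0"
  using word_length_le[of "[]" S] by simp

text \<open>A suffix of a shortest word is a shortest word.\<close>

lemma word_length_values: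
  assumes S: "S \<subseteq> carrier G" "finite S" and inf: "infinite (generate G S)"
  shows "\<exists>g\<in>generate G S. word_length G S g = n"
proof -
  define A where "A = S \<union> m_inv G ` S"
  have A: "finite A" "A \<subseteq> carrier G" using S by (auto simp: A_def)
  \<comment> \<open>Words of bounded length over a finite alphabet give finitely many elements, so
    an infinite group has unbounded lengths.\<close>
  have "\<exists>g\<in>generate G S. n < word_length G S g"
  proof (rule ccontr)
    assume *: "\<not> ?thesis"
    have "generate G S \<subseteq> word_product ` {ws. set ws \<subseteq> A \<and> length ws \<le> n}"
    proof
      fix g assume g: "g \<in> generate G S"
      obtain ws where "set ws \<subseteq> A" "word_product ws = g" "length ws = word_length G S g"
        using word_length_attained[OF S(1) g] unfolding A_def .
      then show "g \<in> word_product ` {ws. set ws \<subseteq> A \<and> length ws \<le> n}"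
        using * g by (force simp: not_less)
    qed
    then show False using inf finite_lists_length_le[OF A(1), of n] finite_surj by blast
  qed
  then obtain g where g: "g \<in> generate G S" "n < word_length G S g" by blast
  obtain ws where ws: "set ws \<subseteq> A" "word_product ws = g" "length ws = word_length G S g"
    using word_length_attained[OF S(1) g(1)] unfolding A_def .
  define us where "us = take (length ws - n) ws"
  define vs where "vs = drop (length ws - n) ws"
  have uv: "ws = us @ vs" "length vs = n" "length us = length ws - n"
    using ws(3) g(2) by (auto simp: us_def vs_def)
  have uvA: "set us \<subseteq> A" "set vs \<subseteq> A" using ws(1) uv(1) by auto
  define h where "h = word_product vs"
  have h: "h \<in> generate G S"
    using generate_iff_word[OF S(1), of h] uvA(2) unfolding A_def h_def by blast
  have "word_length G S h \<le> n" using word_length_le[of vs S] uvA uv(2) by (simp add: h_def A_def)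
  \<comment> \<open>A shorter word for the suffix would shorten the minimal word of
    \<open>g\<close>.\<close>
  moreover have "n \<le> word_length G S h"
  proof -
    obtain xs where xs: "set xs \<subseteq> A" "word_product xs = h" "length xs = word_length G S h"
      using word_length_attained[OF S(1) h] unfolding A_def .
    have "word_product (us @ xs) = g"
      using word_product_append[of us vs] word_product_append[of us xs] subset_trans[OF uvA(1) A(2)]
        subset_trans[OF uvA(2) A(2)] subset_trans[OF xs(1) A(2)] xs(2) ws(2) uv(1)
      by (simp add: h_def)
    then have "word_length G S g \<le> length (us @ xs)"
      using word_length_le[of "us @ xs" S] uvA xs by (simp add: A_def)
    then show ?thesis using uv(3) xs(3) ws(3) g(2) by simp
  qed
  ultimately show ?thesis using h by (intro bexI[of _ h]) auto
qed

end

section \<open>Maximal parabolic subgroups\<close>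

lemma (in group) conjugate_eq_image: "g <# H #> inv g = (\<lambda>h. g \<otimes> h \<otimes> inv g) ` H"
  by (auto simp: l_coset_def r_coset_def)

lemma (in group) mem_conjugate_iff:
  assumes "g \<in> carrier G" "H \<subseteq> carrier G" "x \<in> carrier G"
  shows "x \<in> g <# H #> inv g \<longleftrightarrow> inv g \<otimes> x \<otimes> g \<in> H"
proof
  assume "x \<in> g <# H #> inv g"
  then obtain h where h: "h \<in> H" "x = g \<otimes> h \<otimes> inv g" by (auto simp: l_coset_def r_coset_def)
  then have "h \<in> carrier G" using assms(2) by blast
  then have "inv g \<otimes> x \<otimes> g = (inv g \<otimes> g) \<otimes> h \<otimes> (inv g \<otimes> g)"
    using assms(1) by (simp only: h(2) m_assoc m_closed inv_closed)
  then have "inv g \<otimes> x \<otimes> g = h" using assms(1) \<open>h \<in> carrier G\<close> by simp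
  then show "inv g \<otimes> x \<otimes> g \<in> H" using h by simp
next
  assume *: "inv g \<otimes> x \<otimes> g \<in> H"
  have "x = g \<otimes> (inv g \<otimes> x \<otimes> g) \<otimes> inv g"
    using assms by (metis inv_closed inv_solve_right m_assoc m_closed r_inv l_one)
  then show "x \<in> g <# H #> inv g" using * by (auto simp: l_coset_def r_coset_def)
qed

context isometric_group_action
begin

lemma act_bounded_image:
  assumes "g \<in> carrier G" "bounded (act g ` A)"
  shows "bounded A"
proof -
  obtain x e where "\<forall>y\<in>act g ` A. dist x y \<le> e" using assms(2) by (auto simp: bounded_def)
  then have "\<forall>y\<in>A. dist (act (inv g) x) y \<le> e"
    using assms(1) act_dist_left[of "inv g" x] by simp
  then show ?thesis by (auto simp: bounded_def)
qed

lemma conjugate_orbit: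
  assumes g: "g \<in> carrier G" and H: "H \<subseteq> carrier G"
  shows "(\<lambda>h. act h x) ` (g <# H #> inv g) = act g ` (\<lambda>h. act h (act (inv g) x)) ` H"
proof -
  have "act (g \<otimes> h \<otimes> inv g) x = act g (act h (act (inv g) x))" if "h \<in> H" for h
    using g H that by (auto simp: act_mult subset_iff)
  then show ?thesis unfolding conjugate_eq_image image_image by (intro image_cong refl)
qed

text \<open>One inclusion is enough: the other follows by applying it to \<open>inv g\<close> and
  the conjugate subgroup.\<close>

lemma orbit_accumulation_points_subset:
  assumes g: "g \<in> carrier G" and H: "H \<subseteq> carrier G"
  shows "boundary_act act g ` orbit_accumulation_points act H (act (inv g) x)
    \<subseteq> orbit_accumulation_points act (g <# H #> inv g) x"
proof (clarify)
  fix \<xi> assume "\<xi> \<in> orbit_accumulation_points act H (act (inv g) x)"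
  then obtain h where h: "\<xi> \<in> gromov_boundary" "range h \<subseteq> H" "(\<lambda>n. act (h n) (act (inv g) x)) \<in> \<xi>"
    by (auto simp: orbit_accumulation_points_def)
  define h' where "h' n = g \<otimes> h n \<otimes> inv g" for n
  have "h n \<in> carrier G" for n using h(2) H by auto
  then have "(\<lambda>n. act (h' n) x) = act g \<circ> (\<lambda>n. act (h n) (act (inv g) x))"
    using g by (auto simp: h'_def act_mult)
  then have "(\<lambda>n. act (h' n) x) \<in> boundary_act act g \<xi>" using h(3) by (simp add: boundary_act_def)
  moreover have "range h' \<subseteq> g <# H #> inv g" using h(2) by (auto simp: h'_def l_coset_def r_coset_def)
  ultimately show "boundary_act act g \<xi> \<in> orbit_accumulation_points act (g <# H #> inv g) x"
    using boundary_act_in_boundary[OF g h(1)] unfolding orbit_accumulation_points_def by blast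
qed

lemma conjugate_inverse:
  assumes "g \<in> carrier G" "H \<subseteq> carrier G"
  shows "inv g <# (g <# H #> inv g) #> g = H"
  using subgroup_conjugation_is_surj0[of "inv g" H] assms by simp

lemma parabolic_at_conjugate:
  assumes g: "g \<in> carrier G" and par: "parabolic_at G act H \<xi>"
  shows "parabolic_at G act (g <# H #> inv g) (boundary_act act g \<xi>)"
proof -
  have H: "subgroup H G" "H \<subseteq> carrier G"
    and unb: "\<And>x. \<not> bounded ((\<lambda>h. act h x) ` H)" and acc: "\<And>x. orbit_accumulation_points act H x = {\<xi>}"
    using par by (auto simp: parabolic_at_def dest: subgroup.subset)
  have K: "subgroup (g <# H #> inv g) G" using subgroup_conjugation_is_surj2[OF g H(1)] .
  have "\<not> bounded ((\<lambda>h. act h x) ` (g <# H #> inv g))" for x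
    unfolding conjugate_orbit[OF g H(2)] using act_bounded_image[OF g] unb by blast
  moreover have "orbit_accumulation_points act (g <# H #> inv g) x = {boundary_act act g \<xi>}" for x
  proof (rule antisym)
    show "{boundary_act act g \<xi>} \<subseteq> orbit_accumulation_points act (g <# H #> inv g) x"
      using orbit_accumulation_points_subset[OF g H(2), of x] acc by simp
    have "boundary_act act (inv g) ` orbit_accumulation_points act (g <# H #> inv g) x
        \<subseteq> orbit_accumulation_points act H (act (inv g) x)"
      using orbit_accumulation_points_subset[of "inv g" "g <# H #> inv g" "act (inv g) x"] g
        subgroup.subset[OF K] conjugate_inverse[OF g H(2)] by simp
    then have inv: "boundary_act act (inv g) \<xi>' = \<xi>"
      if "\<xi>' \<in> orbit_accumulation_points act (g <# H #> inv g) x" for \<xi>'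
      using that unfolding acc by blast
    show "orbit_accumulation_points act (g <# H #> inv g) x \<subseteq> {boundary_act act g \<xi>}"
    proof
      fix \<xi>' assume "\<xi>' \<in> orbit_accumulation_points act (g <# H #> inv g) x"
      then show "\<xi>' \<in> {boundary_act act g \<xi>}"
        using boundary_act_inv(2)[OF g, of \<xi>'] inv[of \<xi>'] by simp
    qed
  qed
  ultimately show ?thesis using K by (simp add: parabolic_at_def)
qed

lemma parabolic_points_act:
  "g \<in> carrier G \<Longrightarrow> \<xi> \<in> parabolic_points G act \<Longrightarrow> boundary_act act g \<xi> \<in> parabolic_points G act"
  using parabolic_at_conjugate unfolding parabolic_points_def by blast

lemma stabilizer_conjugate:
  assumes g: "g \<in> carrier G"
  shows "stabilizer G (boundary_act act) (boundary_act act g \<xi>) =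
    g <# stabilizer G (boundary_act act) \<xi> #> inv g"
proof -
  have s: "stabilizer G (boundary_act act) \<xi> \<subseteq> carrier G" by (auto simp: stabilizer_def)
  then have c: "g <# stabilizer G (boundary_act act) \<xi> #> inv g \<subseteq> carrier G"
    using g by (auto simp: l_coset_def r_coset_def)
  have eq: "boundary_act act x (boundary_act act g \<xi>) = boundary_act act g \<xi> \<longleftrightarrow>
      boundary_act act (inv g \<otimes> x \<otimes> g) \<xi> = \<xi>" if "x \<in> carrier G" for x
  proof -
    have "boundary_act act (inv g \<otimes> x \<otimes> g) \<xi> =
        boundary_act act (inv g) (boundary_act act x (boundary_act act g \<xi>))"
      using g that by (simp add: boundary_act_mult)
    then show ?thesis using boundary_act_inv[OF g] by metis
  qed
  have "x \<in> stabilizer G (boundary_act act) (boundary_act act g \<xi>) \<longleftrightarrow>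
      x \<in> g <# stabilizer G (boundary_act act) \<xi> #> inv g" if x: "x \<in> carrier G" for x
    using mem_conjugate_iff[OF g s x] eq[OF x] x g by (simp add: stabilizer_def)
  then show ?thesis using c unfolding stabilizer_def by blast
qed

text \<open>The right-hand side mentions only \<open>G\<close> and \<open>\<P>\<close>, so two
  actions with the same representatives have the same maximal parabolic subgroups. Closure under
  conjugation holds because a conjugate of a stabilizer is the stabilizer of the translated
  parabolic point.\<close>

lemma maximal_parabolic_iff:
  assumes "conjugacy_representatives G (maximal_parabolic_subgroups G act) \<P>"
  shows "Q \<in> maximal_parabolic_subgroups G act \<longleftrightarrow>
    (\<exists>P\<in>\<P>. \<exists>g\<in>carrier G. Q = g <# P #> inv g)"
proof
  assume "\<exists>P\<in>\<P>. \<exists>g\<in>carrier G. Q = g <# P #> inv g"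
  then obtain P g where P: "P \<in> \<P>" "g \<in> carrier G" "Q = g <# P #> inv g" by blast
  then have "P \<in> maximal_parabolic_subgroups G act"
    using assms by (auto simp: conjugacy_representatives_def)
  then obtain \<xi> where "\<xi> \<in> parabolic_points G act" "P = stabilizer G (boundary_act act) \<xi>"
    by (auto simp: maximal_parabolic_subgroups_def)
  then show "Q \<in> maximal_parabolic_subgroups G act"
    using parabolic_points_act[OF P(2)] stabilizer_conjugate[OF P(2)] P(3)
    unfolding maximal_parabolic_subgroups_def by auto
next
  assume "Q \<in> maximal_parabolic_subgroups G act"
  then have "\<exists>!P. P \<in> \<P> \<and> (\<exists>g\<in>carrier G. Q = g <# P #> inv g)"
    using assms unfolding conjugacy_representatives_def by simp
  then show "\<exists>P\<in>\<P>. \<exists>g\<in>carrier G. Q = g <# P #> inv g" by (elim ex1E) blast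
qed

text \<open>Left translation by \<open>h\<close> preserves sequences in \<open>H\<close>, so it
  permits no accumulation point other than \<open>\<xi>\<close> as the image of
  \<open>\<xi>\<close>.\<close>

lemma parabolic_subgroup_subset_stabilizer:
  assumes "parabolic_at G act H \<xi>"
  shows "H \<subseteq> stabilizer G (boundary_act act) \<xi>"
proof
  fix h assume h: "h \<in> H"
  fix x
  have H: "subgroup H G" and acc: "orbit_accumulation_points act H x = {\<xi>}"
    using assms by (auto simp: parabolic_at_def)
  have hc: "h \<in> carrier G" using h subgroup.subset[OF H] by blast
  have "\<xi> \<in> orbit_accumulation_points act H x" by (simp add: acc)
  then obtain r where r: "\<xi> \<in> gromov_boundary" "range r \<subseteq> H" "(\<lambda>n. act (r n) x) \<in> \<xi>"
    unfolding orbit_accumulation_points_def by blast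
  have "r n \<in> carrier G" for n using r(2) subgroup.subset[OF H] by blast
  then have "(\<lambda>n. act (h \<otimes> r n) x) = act h \<circ> (\<lambda>n. act (r n) x)" using hc by (auto simp: act_mult)
  then have "(\<lambda>n. act (h \<otimes> r n) x) \<in> boundary_act act h \<xi>" using r(3) by (simp add: boundary_act_def)
  moreover have "range (\<lambda>n. h \<otimes> r n) \<subseteq> H" using r(2) h subgroup.m_closed[OF H] by auto
  ultimately have "boundary_act act h \<xi> \<in> orbit_accumulation_points act H x"
    using boundary_act_in_boundary[OF hc r(1)] unfolding orbit_accumulation_points_def by blast
  then show "h \<in> stabilizer G (boundary_act act) \<xi>" using acc hc by (simp add: stabilizer_def)
qed

lemma infinite_stabilizer:
  assumes "\<xi> \<in> parabolic_points G act"
  shows "infinite (stabilizer G (boundary_act act) \<xi>)"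
proof
  assume fin: "finite (stabilizer G (boundary_act act) \<xi>)"
  obtain H where H: "parabolic_at G act H \<xi>" using assms by (auto simp: parabolic_points_def)
  then have "finite H" using finite_subset[OF parabolic_subgroup_subset_stabilizer fin] by blast
  then show False using H finite_imp_bounded unfolding parabolic_at_def by blast
qed

end

context cusp_uniform
begin

text \<open>Closed balls are compact and the action is properly discontinuous. Using
  \<open>\<bar>r\<bar>\<close> keeps the centre inside the ball for negative
  \<open>r\<close>.\<close>

lemma finite_bounded_displacement: "finite {g \<in> carrier G. dist y (act g y) \<le> r}"
proof (rule finite_subset)
  show "{g \<in> carrier G. dist y (act g y) \<le> r} \<subseteq>
    {g \<in> carrier G. act g ` cball y \<bar>r\<bar> \<inter> cball y \<bar>r\<bar> \<noteq> {}}"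
  proof (rule Collect_mono, intro impI, elim conjE)
    fix g assume "g \<in> carrier G" "dist y (act g y) \<le> r"
    then have "act g y \<in> act g ` cball y \<bar>r\<bar> \<inter> cball y \<bar>r\<bar>" by simp
    then show "g \<in> carrier G \<and> act g ` cball y \<bar>r\<bar> \<inter> cball y \<bar>r\<bar> \<noteq> {}"
      using \<open>g \<in> carrier G\<close> by blast
  qed
  show "finite {g \<in> carrier G. act g ` cball y \<bar>r\<bar> \<inter> cball y \<bar>r\<bar> \<noteq> {}}"
    using proper discontinuous unfolding proper_space_def properly_discontinuous_def by blast
qed

text \<open>Along a ray to \<open>\<xi>\<close> the horofunction grows at unit rate up to the error
  \<open>D\<close>, hence becomes positive.\<close>

lemma horoball_nonempty:
  assumes \<xi>: "\<xi> \<in> parabolic_points G act"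
  shows "\<exists>y. y \<in> B \<xi>"
proof -
  have b: "\<xi> \<in> gromov_boundary" using \<xi> parabolic_points_subset_boundary by blast
  obtain h D where h: "B \<xi> = h -` {0<..}"
    and D: "\<And>x w c. geodesic_ray_to c x \<xi> \<Longrightarrow> infdist w (c ` {0..}) \<le> 5 * \<delta> \<Longrightarrow>
       \<bar>h w - h x - dist x w\<bar> \<le> D"
    using horoballs \<xi> unfolding cusp_uniform_horoballs_def open_horoball_def horofunction_def by metis
  fix x
  obtain c where c: "geodesic_ray_to c x \<xi>" using ray_exists[OF b] by blast
  define t where "t = \<bar>h x\<bar> + \<bar>D\<bar> + 1"
  have "c t \<in> c ` {0..}" by (simp add: t_def)
  then have "\<bar>h (c t) - h x - dist x (c t)\<bar> \<le> D" using D[OF c, of "c t"] delta_nonneg by simp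
  moreover have "dist x (c t) = t"
    using c geodesic_ray_dist(2)[of c x t t] by (simp add: geodesic_ray_to_def t_def)
  ultimately have "h x + t - D \<le> h (c t)" by linarith
  moreover have "0 < h x + t - D" unfolding t_def by linarith
  ultimately have "c t \<in> B \<xi>" using h by simp
  then show ?thesis by blast
qed

text \<open>Distortion is stated for the stabilizer of the horoball as a set, the boundary estimates
  for the stabilizer of its centre. Disjointness and non-emptiness of the horoballs identify the
  two.\<close>

lemma stabilizer_horoball:
  assumes \<xi>: "\<xi> \<in> parabolic_points G act"
  shows "stabilizer G (\<lambda>g. image (act g)) (B \<xi>) = stab \<xi>"
proof -
  have eq: "B (boundary_act act g \<xi>) = act g ` B \<xi>" if "g \<in> carrier G" for g
    using horoballs \<xi> that by (simp add: cusp_uniform_horoballs_def)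
  have "boundary_act act g \<xi> = \<xi>" if g: "g \<in> carrier G" "act g ` B \<xi> = B \<xi>" for g
  proof (rule ccontr)
    assume "\<not> ?thesis"
    then have "B (boundary_act act g \<xi>) \<inter> B \<xi> = {}"
      using horoballs \<xi> parabolic_points_act[OF g(1) \<xi>]
      unfolding cusp_uniform_horoballs_def disjoint_family_on_def by blast
    then show False using eq[OF g(1)] g(2) horoball_nonempty[OF \<xi>] by auto
  qed
  then show ?thesis using eq unfolding stabilizer_def by force
qed

end

section \<open>Comparison of two cusped spaces\<close>

locale cusp_uniform_pair =
  X1: cusp_uniform \<delta>1 G \<P> act1 B1 + X2: cusp_uniform \<delta>2 G \<P> act2 B2
  for \<delta>1 \<delta>2 :: real and G :: "('g, 'm) monoid_scheme" (structure) and \<P> :: "'g set set"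
    and act1 :: "'g \<Rightarrow> 'x::metric_space \<Rightarrow> 'x" and B1
    and act2 :: "'g \<Rightarrow> 'y::metric_space \<Rightarrow> 'y" and B2 +
  fixes f :: "(nat \<Rightarrow> 'x) set \<Rightarrow> (nat \<Rightarrow> 'y) set" and \<rho>1 \<rho>2
  assumes visual: "visual_metric \<rho>1" "visual_metric \<rho>2"
    and quasisymmetric: "quasisymmetric_homeomorphism gromov_boundary \<rho>1 gromov_boundary \<rho>2 f"
    and equivariant: "\<And>g \<xi>. g \<in> carrier G \<Longrightarrow> \<xi> \<in> gromov_boundary \<Longrightarrow>
           f (boundary_act act1 g \<xi>) = boundary_act act2 g (f \<xi>)"
    and three_points: "\<exists>T\<subseteq>(gromov_boundary :: (nat \<Rightarrow> 'x) set set). card T = 3"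
begin

sublocale M1: Metric_space gromov_boundary \<rho>1 using visual by (simp add: visual_metric_def)
sublocale M2: Metric_space gromov_boundary \<rho>2 using visual by (simp add: visual_metric_def)

lemma f_inj: "inj_on f gromov_boundary"
  and f_image: "f ` gromov_boundary = gromov_boundary"
  using homeomorphic_imp_injective_map[of M1.mtopology M2.mtopology f]
    homeomorphic_imp_surjective_map[of M1.mtopology M2.mtopology f] quasisymmetric
  by (simp_all add: quasisymmetric_homeomorphism_def)

lemma f_in: "\<xi> \<in> gromov_boundary \<Longrightarrow> f \<xi> \<in> gromov_boundary"
  using f_image by blast

text \<open>An element \<open>p\<close> of the common stabilizer with large displacement moves \<open>\<zeta>\<close> close to \<open>\<xi>\<close> and
  \<open>f \<zeta>\<close> close to \<open>\<eta>\<close>.\<close>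

lemma f_fixed_point:
  assumes \<xi>: "\<xi> \<in> parabolic_points G act1" and \<eta>: "\<eta> \<in> parabolic_points G act2"
    and stab: "X1.stab \<xi> = X2.stab \<eta>"
  shows "f \<xi> = \<eta>"
proof (rule ccontr)
  assume ne: "f \<xi> \<noteq> \<eta>"
  have b: "\<xi> \<in> gromov_boundary" "\<eta> \<in> gromov_boundary"
    using \<xi> \<eta> X1.parabolic_points_subset_boundary X2.parabolic_points_subset_boundary by blast+
  obtain T :: "(nat \<Rightarrow> 'x) set set" where T: "T \<subseteq> gromov_boundary" "card T = 3" using three_points by blast
  obtain \<eta>0 where \<eta>0: "\<eta>0 \<in> gromov_boundary" "f \<eta>0 = \<eta>" using f_image b(2) by (metis imageE)
  have "\<not> T \<subseteq> {\<xi>, \<eta>0}"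
    using card_mono[of "{\<xi>, \<eta>0}" T] T(2) card_insert_le_m1[of 2 "{\<eta>0}" \<xi>] by auto
  then obtain \<zeta> where \<zeta>: "\<zeta> \<in> gromov_boundary" "\<zeta> \<noteq> \<xi>" "\<zeta> \<noteq> \<eta>0" using T(1) by blast
  have f\<zeta>: "f \<zeta> \<in> gromov_boundary" "f \<zeta> \<noteq> \<eta>" "f \<zeta> \<noteq> f \<xi>"
    using \<zeta> \<eta>0 b f_in inj_onD[OF f_inj] by blast+
  obtain y1 y2 where y: "y1 \<in> B1 \<xi>" "y2 \<in> B2 \<eta>"
    using X1.horoball_nonempty[OF \<xi>] X2.horoball_nonempty[OF \<eta>] by blast
  obtain \<kappa>1 C1 where k1: "\<kappa>1 > 0" and C1: "\<And>p. p \<in> X1.stab \<xi> \<Longrightarrow> 0 < \<rho>1 \<xi> (boundary_act act1 p \<zeta>) \<and>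
    \<bar>ln (\<rho>1 \<xi> (boundary_act act1 p \<zeta>)) + \<kappa>1 * dist y1 (act1 p y1)\<bar> \<le> C1"
    using X1.stabilizer_visual_metric[OF \<xi> y(1) \<zeta>(1,2) visual(1)] by blast
  obtain \<kappa>2 C2 where k2: "\<kappa>2 > 0" and C2: "\<And>p. p \<in> X2.stab \<eta> \<Longrightarrow> 0 < \<rho>2 \<eta> (boundary_act act2 p (f \<zeta>)) \<and>
    \<bar>ln (\<rho>2 \<eta> (boundary_act act2 p (f \<zeta>))) + \<kappa>2 * dist y2 (act2 p y2)\<bar> \<le> C2"
    using X2.stabilizer_visual_metric[OF \<eta> y(2) f\<zeta>(1,2) visual(2)] by blast
  obtain h h' where h: "homeomorphism {0::real..} {0::real..} h h'"
    and qs: "\<And>t x a b. t \<ge> 0 \<Longrightarrow> x \<in> gromov_boundary \<Longrightarrow> a \<in> gromov_boundary \<Longrightarrow> b \<in> gromov_boundary \<Longrightarrow>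
       \<rho>1 x a \<le> t * \<rho>1 x b \<Longrightarrow> \<rho>2 (f x) (f a) \<le> h t * \<rho>2 (f x) (f b)"
    using quasisymmetric unfolding quasisymmetric_homeomorphism_def by blast
  define \<epsilon> where "\<epsilon> = \<rho>2 \<eta> (f \<xi>)"
  have pos: "0 < \<epsilon>" "0 < \<rho>2 (f \<xi>) (f \<zeta>)" "0 < \<rho>1 \<xi> \<zeta>"
    using M2.mdist_pos_eq M1.mdist_pos_eq b f_in f\<zeta> \<zeta> ne unfolding \<epsilon>_def by metis+
  obtain t where t: "t > 0" "h t \<le> \<epsilon> / (3 * \<rho>2 (f \<xi>) (f \<zeta>))"
    using homeomorphism_halfline_small[OF h, of "\<epsilon> / (3 * \<rho>2 (f \<xi>) (f \<zeta>))"] pos by auto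
  \<comment> \<open>Displacement beyond \<open>r1\<close> brings \<open>p \<zeta>\<close> close
    enough to \<open>\<xi>\<close> for quasisymmetry to put \<open>f (p \<zeta>)\<close> within
    \<open>\<epsilon> / 3\<close> of \<open>f \<xi>\<close>; beyond \<open>r2\<close> it is within
    \<open>\<epsilon> / 3\<close> of \<open>\<eta>\<close>. An infinite stabilizer contains an
    element exceeding both.\<close>
  define r1 where "r1 = (C1 - ln (t * \<rho>1 \<xi> \<zeta>)) / \<kappa>1"
  define r2 where "r2 = (C2 - ln (\<epsilon> / 3)) / \<kappa>2"
  have "finite ({g \<in> carrier G. dist y1 (act1 g y1) \<le> r1} \<union> {g \<in> carrier G. dist y2 (act2 g y2) \<le> r2})"
    using X1.finite_bounded_displacement X2.finite_bounded_displacement by simp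
  then obtain p where p: "p \<in> X1.stab \<xi>"
    "p \<notin> {g \<in> carrier G. dist y1 (act1 g y1) \<le> r1} \<union> {g \<in> carrier G. dist y2 (act2 g y2) \<le> r2}"
    using X1.infinite_stabilizer[OF \<xi>] by (meson finite_subset subsetI)
  have pc: "p \<in> carrier G" and p2: "p \<in> X2.stab \<eta>" using p(1) stab X1.stabilizer_boundary(1) by auto
  have far: "C1 - ln (t * \<rho>1 \<xi> \<zeta>) < \<kappa>1 * dist y1 (act1 p y1)"
    "C2 - ln (\<epsilon> / 3) < \<kappa>2 * dist y2 (act2 p y2)"
    using p(2) pc k1 k2 by (auto simp: r1_def r2_def field_simps)
  define a where "a = boundary_act act1 p \<zeta>"
  have a: "a \<in> gromov_boundary" "f a = boundary_act act2 p (f \<zeta>)"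
    using X1.boundary_act_in_boundary[OF pc \<zeta>(1)] equivariant[OF pc \<zeta>(1)] by (simp_all add: a_def)
  have "ln (\<rho>1 \<xi> a) < ln (t * \<rho>1 \<xi> \<zeta>)" "0 < \<rho>1 \<xi> a"
    using C1[OF p(1)] far(1) by (simp_all add: a_def abs_le_iff)
  then have "\<rho>1 \<xi> a \<le> t * \<rho>1 \<xi> \<zeta>" using t(1) pos(3) by (simp add: ln_less_cancel_iff)
  then have "\<rho>2 (f \<xi>) (f a) \<le> h t * \<rho>2 (f \<xi>) (f \<zeta>)" using qs t(1) b(1) a(1) \<zeta>(1) by simp
  also have "\<dots> \<le> \<epsilon> / 3" using mult_right_mono[OF t(2), of "\<rho>2 (f \<xi>) (f \<zeta>)"] pos(2) by simp
  finally have 1: "\<rho>2 (f \<xi>) (f a) \<le> \<epsilon> / 3" .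
  have "ln (\<rho>2 \<eta> (f a)) < ln (\<epsilon> / 3)" "0 < \<rho>2 \<eta> (f a)"
    using C2[OF p2] far(2) by (simp_all add: a abs_le_iff)
  then have "\<rho>2 \<eta> (f a) < \<epsilon> / 3" using pos(1) by (simp add: ln_less_cancel_iff)
  moreover have "\<epsilon> \<le> \<rho>2 \<eta> (f a) + \<rho>2 (f \<xi>) (f a)"
    using M2.triangle[OF b(2) f_in[OF a(1)] f_in[OF b(1)]] M2.commute[of "f a" "f \<xi>"] by (simp add: \<epsilon>_def)
  ultimately show False using 1 pos(1) by simp
qed

lemma horospherical_distortion_transfer:
  assumes \<xi>: "\<xi> \<in> parabolic_points G act1" and \<eta>: "\<eta> \<in> parabolic_points G act2"
    and stab: "X1.stab \<xi> = X2.stab \<eta>"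
    and chd: "constant_horospherical_distortion G act1 (B1 \<xi>)"
  shows "constant_horospherical_distortion G act2 (B2 \<eta>)"
proof -
  define P where "P = X1.stab \<xi>"
  have P: "stabilizer G (\<lambda>g. image (act1 g)) (B1 \<xi>) = P" "stabilizer G (\<lambda>g. image (act2 g)) (B2 \<eta>) = P"
    using X1.stabilizer_horoball[OF \<xi>] X2.stabilizer_horoball[OF \<eta>] stab by (simp_all add: P_def)
  have PC: "P \<subseteq> carrier G" by (auto simp: P_def stabilizer_def)
  have f\<xi>: "f \<xi> = \<eta>" using f_fixed_point[OF \<xi> \<eta> stab] .
  have b: "\<xi> \<in> gromov_boundary" using \<xi> X1.parabolic_points_subset_boundary by blast
  obtain T :: "(nat \<Rightarrow> 'x) set set" where T: "T \<subseteq> gromov_boundary" "card T = 3" using three_points by blast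
  have "\<not> T \<subseteq> {\<xi>}" using card_mono[of "{\<xi>}" T] T(2) by auto
  then obtain \<zeta> where \<zeta>: "\<zeta> \<in> gromov_boundary" "\<zeta> \<noteq> \<xi>" using T(1) by blast
  have f\<zeta>: "f \<zeta> \<in> gromov_boundary" "f \<zeta> \<noteq> \<eta>"
    using \<zeta> b f_in inj_onD[OF f_inj] f\<xi> by blast+
  obtain y1 where y1: "y1 \<in> B1 \<xi>" using X1.horoball_nonempty[OF \<xi>] by blast
  obtain h h' where h: "homeomorphism {0::real..} {0::real..} h h'"
    and qs: "\<And>t x a b. t \<ge> 0 \<Longrightarrow> x \<in> gromov_boundary \<Longrightarrow> a \<in> gromov_boundary \<Longrightarrow> b \<in> gromov_boundary \<Longrightarrow>
       \<rho>1 x a \<le> t * \<rho>1 x b \<Longrightarrow> \<rho>2 (f x) (f a) \<le> h t * \<rho>2 (f x) (f b)"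
    using quasisymmetric unfolding quasisymmetric_homeomorphism_def by blast
  obtain \<kappa>1 C1 where k1: "\<kappa>1 > 0" and C1: "\<And>p. p \<in> P \<Longrightarrow> 0 < \<rho>1 \<xi> (boundary_act act1 p \<zeta>)"
    "\<And>p. p \<in> P \<Longrightarrow> \<bar>ln (\<rho>1 \<xi> (boundary_act act1 p \<zeta>)) + \<kappa>1 * dist y1 (act1 p y1)\<bar> \<le> C1"
    using X1.stabilizer_visual_metric[OF \<xi> y1 \<zeta> visual(1)] unfolding P_def by blast
  have "\<exists>g2 b'. bilipschitz_homeomorphism g2 \<and> b' > 0 \<and> (\<forall>p\<in>P. \<forall>q\<in>P. p \<noteq> q \<longrightarrow>
      1 / b' * exp (g2 (dist (act2 p y) (act2 q y))) \<le> word_metric G S p q \<and>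
      word_metric G S p q \<le> b' * exp (g2 (dist (act2 p y) (act2 q y))))"
    if S: "finite_generating_set G P S" and y: "y \<in> B2 \<eta>" for S y
  proof -
    have SP: "finite S" "S \<subseteq> carrier G" "generate G S = P"
      using S PC by (auto simp: finite_generating_set_def)
    have sub: "subgroup P G" using X1.generate_is_subgroup[OF SP(2)] SP(3) by simp
    obtain \<kappa>2 C2 where k2: "\<kappa>2 > 0"
      and C2: "\<And>p. p \<in> P \<Longrightarrow> 0 < \<rho>2 \<eta> (boundary_act act2 p (f \<zeta>))"
      "\<And>p. p \<in> P \<Longrightarrow> \<bar>ln (\<rho>2 \<eta> (boundary_act act2 p (f \<zeta>))) + \<kappa>2 * dist y (act2 p y)\<bar> \<le> C2"
      using X2.stabilizer_visual_metric[OF \<eta> y f\<zeta> visual(2)] stab unfolding P_def by auto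
    \<comment> \<open>Equivariance rewrites \<open>f (p \<zeta>)\<close> as
      \<open>p (f \<zeta>)\<close>, so the images stay in one orbit, centred at
      \<open>\<eta>\<close>.\<close>
    have qsP: "\<rho>2 \<eta> (boundary_act act2 p (f \<zeta>)) \<le> h t * \<rho>2 \<eta> (boundary_act act2 q (f \<zeta>))"
      if "0 \<le> t" "p \<in> P" "q \<in> P"
        "\<rho>1 \<xi> (boundary_act act1 p \<zeta>) \<le> t * \<rho>1 \<xi> (boundary_act act1 q \<zeta>)" for t p q
      using qs[OF that(1) b _ _ that(4)] X1.boundary_act_in_boundary \<zeta>(1) equivariant that(2,3) PC f\<xi>
      by (auto simp: subset_iff)
    note comparison = quasisymmetric_comparison[where P = P and \<eta> = h and \<eta>' = h'
      and ?r1.0 = "\<lambda>p. \<rho>1 \<xi> (boundary_act act1 p \<zeta>)" and ?d1.0 = "\<lambda>p. dist y1 (act1 p y1)"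
      and ?r2.0 = "\<lambda>p. \<rho>2 \<eta> (boundary_act act2 p (f \<zeta>))" and ?d2.0 = "\<lambda>p. dist y (act2 p y)"
      and ?\<kappa>1.0 = \<kappa>1 and ?C1.0 = C1 and ?\<kappa>2.0 = \<kappa>2 and ?C2.0 = C2]
    have coarse: "\<exists>S. \<forall>p\<in>P. \<forall>q\<in>P. dist y1 (act1 q y1) \<le> dist y1 (act1 p y1) + s \<longrightarrow>
        dist y (act2 q y) \<le> dist y (act2 p y) + S"
      "\<exists>R. \<forall>p\<in>P. \<forall>q\<in>P. dist y1 (act1 q y1) + R \<le> dist y1 (act1 p y1) \<longrightarrow>
        dist y (act2 q y) + 1 \<le> dist y (act2 p y)" for s
      by (rule comparison; fact h qsP C1 C2 k1 k2)+
    \<comment> \<open>The identity has length 0, which no exponential bound can match; the law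
      concerns distinct pairs only.\<close>
    define Q where "Q = P - {\<one>}"
    define len where "len = word_length G S"
    obtain g1 b1 where g1: "bilipschitz_homeomorphism g1" "b1 > 0"
      and d: "\<And>p q. p \<in> P \<Longrightarrow> q \<in> P \<Longrightarrow> p \<noteq> q \<Longrightarrow>
         1 / b1 * exp (g1 (dist (act1 p y1) (act1 q y1))) \<le> word_metric G S p q \<and>
         word_metric G S p q \<le> b1 * exp (g1 (dist (act1 p y1) (act1 q y1)))"
      using chd S y1 unfolding constant_horospherical_distortion_def Let_def P by blast
    have one: "\<one> \<in> P" using subgroup.one_closed[OF sub] .
    have d1: "1 / b1 * exp (g1 (dist y1 (act1 p y1))) \<le> real (len p) \<and>
        real (len p) \<le> b1 * exp (g1 (dist y1 (act1 p y1)))" if "p \<in> Q" for p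
      using d[OF one, of p] that PC by (auto simp: Q_def word_metric_def len_def subset_iff)
    have "\<exists>g2 b'. bilipschitz_homeomorphism g2 \<and> b' > 0 \<and>
      (\<forall>p\<in>Q. 1 / b' * exp (g2 (dist y (act2 p y))) \<le> real (len p) \<and>
        real (len p) \<le> b' * exp (g2 (dist y (act2 p y))))"
    proof (rule exponential_distortion_transfer[OF g1(1), where ?d1.0 = "\<lambda>p. dist y1 (act1 p y1)" and b = b1])
      show "1 \<le> len p" if "p \<in> Q" for p
        using X1.word_length_pos[OF SP(2)] SP(3) that by (simp add: Q_def len_def)
      show "\<exists>p\<in>Q. len p = n" if "1 \<le> n" for n
      proof -
        have "infinite (generate G S)" using X1.infinite_stabilizer[OF \<xi>] SP(3) by (simp add: P_def)
        then obtain p where "p \<in> P" "len p = n"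
          using X1.word_length_values[OF SP(2,1)] SP(3) unfolding len_def by blast
        moreover have "p \<noteq> \<one>" using \<open>len p = n\<close> that by (auto simp: len_def)
        ultimately show ?thesis by (auto simp: Q_def)
      qed
      show "\<exists>S. \<forall>p\<in>Q. \<forall>q\<in>Q. dist y1 (act1 q y1) \<le> dist y1 (act1 p y1) + s \<longrightarrow>
          dist y (act2 q y) \<le> dist y (act2 p y) + S" for s
        using coarse(1)[of s] unfolding Q_def by blast
      show "\<exists>R. \<forall>p\<in>Q. \<forall>q\<in>Q. dist y1 (act1 q y1) + R \<le> dist y1 (act1 p y1) \<longrightarrow>
          dist y (act2 q y) + 1 \<le> dist y (act2 p y)"
        using coarse(2) unfolding Q_def by blast
    qed (use d1 g1(2) in auto)
    then obtain g2 b' where g2: "bilipschitz_homeomorphism g2" "b' > 0"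
      and d2: "\<And>p. p \<in> Q \<Longrightarrow> 1 / b' * exp (g2 (dist y (act2 p y))) \<le> real (len p) \<and>
        real (len p) \<le> b' * exp (g2 (dist y (act2 p y)))" by blast
    \<comment> \<open>Word metric and displacement are both left invariant, so a pair reduces to the
      single element \<open>inv p \<otimes> q\<close>.\<close>
    have "1 / b' * exp (g2 (dist (act2 p y) (act2 q y))) \<le> word_metric G S p q \<and>
      word_metric G S p q \<le> b' * exp (g2 (dist (act2 p y) (act2 q y)))"
      if pq: "p \<in> P" "q \<in> P" "p \<noteq> q" for p q
    proof -
      have c: "p \<in> carrier G" "q \<in> carrier G" using pq PC by auto
      have "inv p \<otimes> q \<in> Q"
        using pq c subgroup.m_closed[OF sub subgroup.m_inv_closed[OF sub pq(1)] pq(2)]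
        by (auto simp: Q_def X1.inv_solve_left' dest: X1.inv_equality)
      moreover have "dist (act2 p y) (act2 q y) = dist y (act2 (inv p \<otimes> q) y)"
        using c X2.act_dist_left[of p y] by (simp add: X2.act_mult)
      ultimately show ?thesis using d2 by (simp add: word_metric_def len_def)
    qed
    then show ?thesis using g2 by blast
  qed
  moreover have "\<exists>S. finite_generating_set G P S"
    using chd unfolding constant_horospherical_distortion_def Let_def P by blast
  ultimately show ?thesis
    unfolding constant_horospherical_distortion_def Let_def P by blast
qed

end

theorem theorem1p7:
  fixes G :: "('g, 'm) monoid_scheme" and \<P> :: "'g set set"
    and \<delta>1 \<delta>2 :: real
    and act1 :: "'g \<Rightarrow> 'x::metric_space \<Rightarrow> 'x"
    and act2 :: "'g \<Rightarrow> 'y::metric_space \<Rightarrow> 'y"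
    and f :: "(nat \<Rightarrow> 'x) set \<Rightarrow> (nat \<Rightarrow> 'y) set"
  assumes "group_pair G \<P>"
    and "relatively_hyperbolic TYPE('z::metric_space) G \<P>"
    and "\<And>P. P \<in> \<P> \<Longrightarrow> \<exists>S. finite_generating_set G P S"
    and "weak_cusped_space \<delta>1 G \<P> act1"
    and "weak_cusped_space \<delta>2 G \<P> act2"
    and "\<exists>T\<subseteq>(gromov_boundary :: (nat \<Rightarrow> 'x) set set). card T = 3"
    and "\<exists>T\<subseteq>(gromov_boundary :: (nat \<Rightarrow> 'y) set set). card T = 3"
    and "boundary_quasisymmetric f"
    and "\<And>g \<xi>. g \<in> carrier G \<Longrightarrow> \<xi> \<in> gromov_boundary \<Longrightarrow>
           f (boundary_act act1 g \<xi>) = boundary_act act2 g (f \<xi>)"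
    and "cusped_space \<delta>1 G \<P> act1"
  shows "cusped_space \<delta>2 G \<P> act2"
proof -
  obtain B1 where B1: "cusp_uniform_action_with \<delta>1 G \<P> act1 B1"
    "\<And>\<xi>. \<xi> \<in> parabolic_points G act1 \<Longrightarrow> constant_horospherical_distortion G act1 (B1 \<xi>)"
    using assms(10) unfolding cusped_space_def by blast
  obtain B2 where B2: "cusp_uniform_action_with \<delta>2 G \<P> act2 B2"
    using assms(5) unfolding weak_cusped_space_def by blast
  obtain \<rho>1 \<rho>2 where \<rho>: "visual_metric \<rho>1" "visual_metric \<rho>2"
    "quasisymmetric_homeomorphism gromov_boundary \<rho>1 gromov_boundary \<rho>2 f"
    using assms(8) unfolding boundary_quasisymmetric_def by blast
  interpret cusp_uniform_pair \<delta>1 \<delta>2 G \<P> act1 B1 act2 B2 f \<rho>1 \<rho>2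
    by unfold_locales (use B1(1) B2 \<rho> assms(6,9) in auto)
  have "constant_horospherical_distortion G act2 (B2 \<eta>)" if \<eta>: "\<eta> \<in> parabolic_points G act2" for \<eta>
  proof -
    \<comment> \<open>The common representatives \<open>\<P>\<close> supply, for each parabolic
      point of the second space, one of the first with the same stabilizer.\<close>
    have "X2.stab \<eta> \<in> maximal_parabolic_subgroups G act1"
      using \<eta> X2.maximal_parabolic_iff[OF X2.conjugacy, of "X2.stab \<eta>"]
        X1.maximal_parabolic_iff[OF X1.conjugacy, of "X2.stab \<eta>"]
      unfolding maximal_parabolic_subgroups_def by auto
    then obtain \<xi> where "\<xi> \<in> parabolic_points G act1" "X1.stab \<xi> = X2.stab \<eta>"
      by (auto simp: maximal_parabolic_subgroups_def)
    then show ?thesis using horospherical_distortion_transfer[OF _ \<eta>] B1(2) by blast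
  qed
  then show ?thesis using B2 unfolding cusped_space_def by blast
qed

end
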